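(* Let $n\ge 1$ and let $I\subset\mathbb{R}$ be an open interval. Given $n+1$ smooth functions $\kappa_1(s),\dots,\kappa_n(s)$ and $\tau(s)$ on $I$, there exists a non-degenerate horizontally regular curve $\gamma: I\to H_n$, parametrized by horizontal arc-length $s$, such that $\kappa_1,\dots,\kappa_n$ are the p-curvatures of $\gamma$ and $\tau$ is the contact normality of $\gamma$. In addition, any two non-degenerate horizontally regular curves parametrized by horizontal arc-length and having these same p-curvatures $\kappa_1,\dots,\kappa_n$ and contact normality $\tau$ differ by a rigid motion: if $\gamma_1,\gamma_2$ are two such curves, there is $\Phi\in PSH(n)$ with $\gamma_2=\Phi\circ\gamma_1$.
   Context: Heisenberg group. $H_n$ is $\mathbb{R}^{2n+1}$ with coordinates $(x_1,\dots,x_n,y_1,\dots,y_n,z)$ and group law $(x,y,z)\circ(\tilde x,\tilde y,\tilde z)=(x+\tilde x,\,y+\tilde y,\,z+\tilde z+\sum_{j=1}^n(y_j\tilde x_j-x_j\tilde y_j))$. Left invariant vector fields: $\mathring e_j=\partial_{x_j}+y_j\partial_z$, $\mathring e_{n+j}=\partial_{y_j}-x_j\partial_z$ $(1\le j\le n)$, $T=\partial_z$. The contact bundle $\xi$ is spanned by $\mathring e_1,\dots,\mathring e_{2n}$; it is the kernel of $\theta=dz+\sum_{j=1}^n(x_j\,dy_j-y_j\,dx_j)$. The almost complex structure $J$ on $\xi$ is $J\mathring e_j=\mathring e_{n+j}$, $J\mathring e_{n+j}=-\mathring e_j$. The Levi metric is the inner product on $\xi$ for which $\mathring e_1,\dots,\mathring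 e_{2n}$ are orthonormal; $\langle\cdot,\cdot\rangle$ denotes its extension to the tangent bundle making $T$ a unit vector orthogonal to $\xi$. $PSH(n)$ (the group of rigid motions, or symmetries) is the group of diffeomorphisms $\Phi:H_n\to H_n$ with $\Phi_*(\xi)=\xi$, $\Phi_*J=J\Phi_*$ on $\xi$, and $\Phi^*\theta=\theta$. Curves. All curves are smooth. For a curve $\gamma$ in $H_n$, $\gamma^{(k)}$ is the $k$-th coordinate derivative in $\mathbb{R}^{2n+1}$, decomposed as $\gamma^{(k)}=\gamma^{(k)}_\xi+\gamma^{(k)}_T$ with $\gamma^{(k)}_\xi\in\xi$ and $\gamma^{(k)}_T$ a multiple of $T$ at the point of the curve; thus $\gamma^{(k)}_\xi=\sum_j (x_j^{(k)}\mathring e_j+y_j^{(k)}\mathring e_{n+j})$. The curve is horizontally regular if $\gamma'_\xi\neq0$ everywhere, and is parametrized by horizontal arc-length $s$ if $|\gamma'_\xi(s)|=1$ for all $s$. A non-degenerate horizontally regular curve is a horizontally regular curve such that for all $t$: (i) $\gamma'_\xi(t)\wedge\cdots\wedge\gamma^{(n)}_\xi(t)\neq0$ (real wedge product), and (ii) the real span of $\{\gamma'_\xi(t),\dots,\gamma^{(n)}_\xi(t)\}$ is totally real, where a real subspace $P\subset\xi$ is totally real if $JX\notin P$ for every nonzero $X\in P$. Oriented frames, p-curvatures, contact normality. An oriented frame at $p\in H_n$ is $(p;e_1,\dots,e_{2n},T)$ with $e_1,\dots,e_{2n}$ an orthonormal basis of $\xi_p$ and $e_{n+j}=Je_j$ for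 $1\le j\le n$ (the space of oriented frames is identified with $PSH(n)$). Along a non-degenerate horizontally regular curve $\gamma(s)$ parametrized by horizontal arc-length one chooses a smooth oriented frame $(\gamma(s);e_1(s),\dots,e_{2n}(s),T)$ such that for $1\le j\le n$ $$e_1(s)\wedge\cdots\wedge e_j(s)=\pm\frac{\gamma'_\xi(s)\wedge\cdots\wedge\gamma_\xi^{(j)}(s)}{|\gamma'_\xi(s)\wedge\cdots\wedge\gamma_\xi^{(j)}(s)|},\qquad e_{n+j}(s)=Je_j(s).$$ With respect to such a frame, the p-curvatures are $\kappa_j(s)=\langle \frac{de_j}{ds},e_{j+1}\rangle$ for $1\le j\le n-1$ and $\kappa_n(s)=\langle\frac{de_n}{ds},e_{2n}\rangle$, and the contact normality is $\tau(s)=\langle\gamma'(s),T\rangle$. Here $\frac{de_j}{ds}$ is the derivative of $e_j(s)$ as an $\mathbb{R}^{2n+1}$-valued function; its component in $\xi$ is obtained by differentiating the coefficients of $e_j$ with respect to $\mathring e_1,\dots,\mathring e_{2n}$.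
   Formalization: Existence is stated for κ_1,…,κ_{n-1} nowhere zero on I (no condition on κ_n, τ, or when n=1). This is necessary: κ_j(s)=0 for some j<n makes the wedge of the horizontal derivatives vanish, contradicting non-degeneracy. Uniqueness is unrestricted. *)

theory Defs
  imports "HOL-Analysis.Analysis"
begin

text \<open>
  Smoothness, meant for an open set \<open>S\<close>: all iterated directional derivatives exist and are
  differentiable.  The library has no \<open>C\<^sup>\<infinity>\<close> predicate.
\<close>

primrec Ck_on :: "nat \<Rightarrow> 'a::real_normed_vector set \<Rightarrow> ('a \<Rightarrow> 'b::real_normed_vector) \<Rightarrow> bool" where
  "Ck_on 0 S f \<longleftrightarrow> continuous_on S f"
| "Ck_on (Suc k) S f \<longleftrightarrow>
     (\<forall>x\<in>S. f differentiable (at x)) \<and> (\<forall>v. Ck_on k S (\<lambda>x. frechet_derivative f (at x) v))"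

definition smooth_on :: "'a::real_normed_vector set \<Rightarrow> ('a \<Rightarrow> 'b::real_normed_vector) \<Rightarrow> bool" where
  "smooth_on S f \<longleftrightarrow> (\<forall>k. Ck_on k S f)"

definition nth_vector_derivative :: "nat \<Rightarrow> (real \<Rightarrow> 'a::real_normed_vector) \<Rightarrow> real \<Rightarrow> 'a" where
  "nth_vector_derivative k f = ((\<lambda>g t. vector_derivative g (at t)) ^^ k) f"


text \<open>
  The Heisenberg group \<open>H\<^sub>n\<close> with \<open>n = CARD('n)\<close>: a point is \<open>(x, y, z)\<close>.  The coordinate pairs
  \<open>(x\<^sub>j, y\<^sub>j)\<close> are indexed by \<open>'n\<close> (their order plays no role), whereas frames and curvatures are
  indexed by natural numbers starting from 1.  Tangent vectors at any point are elements of the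
  same vector space, written in the coordinate basis \<open>\<partial>\<^sub>x, \<partial>\<^sub>y, \<partial>\<^sub>z\<close>.
\<close>

type_synonym 'n heis = "(real ^ 'n) \<times> (real ^ 'n) \<times> real"

definition e_x :: "'n::finite heis \<Rightarrow> 'n \<Rightarrow> 'n heis" where
  "e_x p j = (axis j 1, 0, fst (snd p) $ j)"

definition e_y :: "'n::finite heis \<Rightarrow> 'n \<Rightarrow> 'n heis" where
  "e_y p j = (0, axis j 1, - (fst p $ j))"

definition e_T :: "'n::finite heis" where
  "e_T = (0, 0, 1)"

definition contact_form :: "'n::finite heis \<Rightarrow> 'n heis \<Rightarrow> real" where
  "contact_form p v =
     snd (snd v) + (\<Sum>j\<in>UNIV. fst p $ j * fst (snd v) $ j - fst (snd p) $ j * fst v $ j)"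

definition contact_space :: "'n::finite heis \<Rightarrow> 'n heis set" where
  "contact_space p = span (range (e_x p) \<union> range (e_y p))"

text \<open>
  Every tangent vector \<open>v = (a, b, c)\<close> at \<open>p\<close> equals
  \<open>\<Sum>\<^sub>j (a\<^sub>j e_x p j + b\<^sub>j e_y p j) + contact_form p v \<cdot> e_T\<close>.  This gives its component in the
  contact space and the formulas for \<open>J\<close> and the metric below.
\<close>

definition horizontal_part :: "'n::finite heis \<Rightarrow> 'n heis \<Rightarrow> 'n heis" where
  "horizontal_part p v = (\<Sum>j\<in>UNIV. fst v $ j *\<^sub>R e_x p j + fst (snd v) $ j *\<^sub>R e_y p j)"

text \<open>\<open>J\<close> is only meaningful on the contact space; as a total function it annihilates \<open>e_T\<close>.\<close>

definition J :: "'n::finite heis \<Rightarrow> 'n heis \<Rightarrow> 'n heis" where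
  "J p v = (\<Sum>j\<in>UNIV. fst v $ j *\<^sub>R e_y p j - fst (snd v) $ j *\<^sub>R e_x p j)"

text \<open>The metric for which all \<open>e_x p j\<close>, \<open>e_y p j\<close> and \<open>e_T\<close> are orthonormal at \<open>p\<close>.\<close>

definition levi :: "'n::finite heis \<Rightarrow> 'n heis \<Rightarrow> 'n heis \<Rightarrow> real" where
  "levi p v w =
     (\<Sum>j\<in>UNIV. fst v $ j * fst w $ j + fst (snd v) $ j * fst (snd w) $ j)
     + contact_form p v * contact_form p w"

definition PSH :: "('n::finite heis \<Rightarrow> 'n heis) set" where
  "PSH = {\<Phi>. bij \<Phi> \<and> smooth_on UNIV \<Phi> \<and> smooth_on UNIV (inv \<Phi>)
     \<and> (\<forall>p. frechet_derivative \<Phi> (at p) ` contact_space p = contact_space (\<Phi> p))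
     \<and> (\<forall>p. \<forall>v\<in>contact_space p.
          frechet_derivative \<Phi> (at p) (J p v) = J (\<Phi> p) (frechet_derivative \<Phi> (at p) v))
     \<and> (\<forall>p v. contact_form (\<Phi> p) (frechet_derivative \<Phi> (at p) v) = contact_form p v)}"


text \<open>
  For an inner product \<open>g\<close>, the wedge product \<open>v\<^sub>1 \<and> \<dots> \<and> v\<^sub>j\<close> is represented by the alternating
  form \<open>(w\<^sub>1, \<dots>, w\<^sub>j) \<mapsto> det (g (v\<^sub>a) (w\<^sub>b))\<close>, that is, by its pairing with \<open>w\<^sub>1 \<and> \<dots> \<and> w\<^sub>j\<close>
  under the inner product induced by \<open>g\<close> on the \<open>j\<close>-th exterior power.  As this inner product is
  non-degenerate, the representation is faithful, and the induced norm is the square root of the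
  pairing of a wedge product with itself.
\<close>

definition wedge :: "('a \<Rightarrow> 'a \<Rightarrow> real) \<Rightarrow> nat \<Rightarrow> (nat \<Rightarrow> 'a) \<Rightarrow> (nat \<Rightarrow> 'a) \<Rightarrow> real" where
  "wedge g j v = (\<lambda>w. \<Sum>\<pi> | \<pi> permutes {1..j}. of_int (sign \<pi>) * (\<Prod>a\<in>{1..j}. g (v a) (w (\<pi> a))))"

definition wedge_norm :: "('a \<Rightarrow> 'a \<Rightarrow> real) \<Rightarrow> nat \<Rightarrow> (nat \<Rightarrow> 'a) \<Rightarrow> real" where
  "wedge_norm g j v = sqrt (wedge g j v v)"

definition totally_real :: "'n::finite heis \<Rightarrow> 'n heis set \<Rightarrow> bool" where
  "totally_real p P \<longleftrightarrow>
     subspace P \<and> P \<subseteq> contact_space p \<and> (\<forall>X\<in>P. X \<noteq> 0 \<longrightarrow> J p X \<notin> P)"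


text \<open>
  A curve on an open interval \<open>I\<close> is a function on the whole real line of which only the
  restriction to \<open>I\<close> matters.
\<close>

definition horizontal_deriv :: "(real \<Rightarrow> 'n::finite heis) \<Rightarrow> nat \<Rightarrow> real \<Rightarrow> 'n heis" where
  "horizontal_deriv \<gamma> k t = horizontal_part (\<gamma> t) (nth_vector_derivative k \<gamma> t)"

definition horizontally_regular :: "real set \<Rightarrow> (real \<Rightarrow> 'n::finite heis) \<Rightarrow> bool" where
  "horizontally_regular I \<gamma> \<longleftrightarrow> smooth_on I \<gamma> \<and> (\<forall>t\<in>I. horizontal_deriv \<gamma> 1 t \<noteq> 0)"

definition horizontal_arclength :: "real set \<Rightarrow> (real \<Rightarrow> 'n::finite heis) \<Rightarrow> bool" where
  "horizontal_arclength I \<gamma> \<longleftrightarrow>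
     (\<forall>s\<in>I. sqrt (levi (\<gamma> s) (horizontal_deriv \<gamma> 1 s) (horizontal_deriv \<gamma> 1 s)) = 1)"

definition nondegenerate :: "real set \<Rightarrow> (real \<Rightarrow> 'n::finite heis) \<Rightarrow> bool" where
  "nondegenerate I \<gamma> \<longleftrightarrow> horizontally_regular I \<gamma>
     \<and> (\<forall>t\<in>I. wedge (levi (\<gamma> t)) CARD('n) (\<lambda>k. horizontal_deriv \<gamma> k t) \<noteq> (\<lambda>_. 0))
     \<and> (\<forall>t\<in>I. totally_real (\<gamma> t) (span ((\<lambda>k. horizontal_deriv \<gamma> k t) ` {1..CARD('n)})))"

text \<open>The last member \<open>T\<close> of an oriented frame is \<open>e_T\<close> and is left implicit.\<close>

definition oriented_frame :: "'n::finite heis \<Rightarrow> (nat \<Rightarrow> 'n heis) \<Rightarrow> bool" where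
  "oriented_frame p e \<longleftrightarrow>
     span (e ` {1..2 * CARD('n)}) = contact_space p
     \<and> (\<forall>i\<in>{1..2 * CARD('n)}. \<forall>k\<in>{1..2 * CARD('n)}. levi p (e i) (e k) = (if i = k then 1 else 0))
     \<and> (\<forall>j\<in>{1..CARD('n)}. e (CARD('n) + j) = J p (e j))"

definition adapted_frame ::
  "real set \<Rightarrow> (real \<Rightarrow> 'n::finite heis) \<Rightarrow> (nat \<Rightarrow> real \<Rightarrow> 'n heis) \<Rightarrow> bool" where
  "adapted_frame I \<gamma> e \<longleftrightarrow>
     (\<forall>i\<in>{1..2 * CARD('n)}. smooth_on I (e i))
     \<and> (\<forall>s\<in>I. oriented_frame (\<gamma> s) (\<lambda>i. e i s))
     \<and> (\<forall>s\<in>I. \<forall>j\<in>{1..CARD('n)}. \<exists>\<epsilon>\<in>{1, -1}. \<forall>w.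
          wedge (levi (\<gamma> s)) j (\<lambda>i. e i s) w
          = \<epsilon> * (wedge (levi (\<gamma> s)) j (\<lambda>k. horizontal_deriv \<gamma> k s) w
                 / wedge_norm (levi (\<gamma> s)) j (\<lambda>k. horizontal_deriv \<gamma> k s)))"

definition p_curvature ::
  "(real \<Rightarrow> 'n::finite heis) \<Rightarrow> (nat \<Rightarrow> real \<Rightarrow> 'n heis) \<Rightarrow> nat \<Rightarrow> real \<Rightarrow> real" where
  "p_curvature \<gamma> e j s =
     levi (\<gamma> s) (vector_derivative (e j) (at s))
       (if j < CARD('n) then e (j + 1) s else e (2 * CARD('n)) s)"

text \<open>
  An adapted frame is determined by the curve only up to signs, so the p-curvatures of a curve are
  defined relative to a choice of adapted frame.  The wedge condition of non-degeneracy forces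
  \<open>\<kappa>\<^sub>j\<close> to vanish nowhere for \<open>j < n\<close>: for instance \<open>\<kappa>\<^sub>1 = 0\<close> at a point would give
  \<open>\<gamma>'' = 0\<close> for the horizontal part there.  No such restriction holds for \<open>\<kappa>\<^sub>n\<close> and \<open>\<tau>\<close>.
\<close>

definition has_p_curvatures ::
  "real set \<Rightarrow> (real \<Rightarrow> 'n::finite heis) \<Rightarrow> (nat \<Rightarrow> real \<Rightarrow> real) \<Rightarrow> bool" where
  "has_p_curvatures I \<gamma> \<kappa> \<longleftrightarrow>
     (\<exists>e. adapted_frame I \<gamma> e \<and> (\<forall>j\<in>{1..CARD('n)}. \<forall>s\<in>I. p_curvature \<gamma> e j s = \<kappa> j s))"

definition has_contact_normality ::
  "real set \<Rightarrow> (real \<Rightarrow> 'n::finite heis) \<Rightarrow> (real \<Rightarrow> real) \<Rightarrow> bool" where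
  "has_contact_normality I \<gamma> \<tau> \<longleftrightarrow>
     (\<forall>s\<in>I. levi (\<gamma> s) (vector_derivative \<gamma> (at s)) e_T = \<tau> s)"

definition curve_with_invariants ::
  "real set \<Rightarrow> (nat \<Rightarrow> real \<Rightarrow> real) \<Rightarrow> (real \<Rightarrow> real) \<Rightarrow> (real \<Rightarrow> 'n::finite heis) \<Rightarrow> bool" where
  "curve_with_invariants I \<kappa> \<tau> \<gamma> \<longleftrightarrow>
     nondegenerate I \<gamma> \<and> horizontal_arclength I \<gamma>
     \<and> has_p_curvatures I \<gamma> \<kappa> \<and> has_contact_normality I \<gamma> \<tau>"

end

theory Submission
  imports Defs
begin

text \<open>
  Forgetting the last coordinate of \<open>H\<^sub>n\<close> projects it to \<open>\<complex>\<^sup>n\<close>, modelled here as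
  \<open>(real ^ 'n) \<times> (real ^ 'n)\<close> with multiplication by \<open>\<i>\<close> written \<open>rot\<close>.  A tangent vector is
  determined by its projection and its value under the contact form.  The contact space at a point
  is thereby identified with \<open>\<complex>\<^sup>n\<close>, its metric with the Euclidean inner product, \<open>J\<close> with
  \<open>rot\<close>, and the horizontal derivatives of a curve with the ordinary derivatives \<open>Z\<^sub>k\<close> of the
  projected curve.  The contact normality prescribes the contact form on the velocity, so it
  determines the last coordinate of the curve by one integration.  What remains is a Frenet theory
  of curves in \<open>\<complex>\<^sup>n\<close> under the unitary group.

  An adapted frame becomes a moving unitary basis \<open>E\<^sub>1, \<dots>, E\<^sub>n\<close> of \<open>\<complex>\<^sup>n\<close> which satisfies
  \<open>E\<^sub>j' = - \<kappa>\<^sub>j\<^sub>-\<^sub>1 E\<^sub>j\<^sub>-\<^sub>1 + \<kappa>\<^sub>j E\<^sub>j\<^sub>+\<^sub>1\<close> for \<open>j < n\<close> and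
  \<open>E\<^sub>n' = - \<kappa>\<^sub>n\<^sub>-\<^sub>1 E\<^sub>n\<^sub>-\<^sub>1 + \<kappa>\<^sub>n rot E\<^sub>n\<close>.
  Together with the derivatives of the vectors \<open>E\<^sub>n\<^sub>+\<^sub>j = rot E\<^sub>j\<close> this is a linear system of size
  \<open>2n\<close> with a real skew-symmetric matrix, \<open>frenet\<close>.  Skewness preserves the Gram matrix of a
  solution and makes a solution unique for its initial values by conservation of energy.

  Existence: solve the system with a unitary basis as initial value (\<open>linear_system_has_solution\<close>).
  The solution stays unitary (\<open>frenet_frame_exists\<close>).  Integrate \<open>E\<^sub>1\<close> to get the projected curve and
  integrate once more for the last coordinate.  By the Frenet equations \<open>Z\<^sub>k\<close> is a combination of
  \<open>E\<^sub>1, \<dots>, E\<^sub>k\<close> with \<open>E\<^sub>k\<close>-coefficient \<open>\<kappa>\<^sub>1 \<cdots> \<kappa>\<^sub>k\<^sub>-\<^sub>1\<close>, which vanishes nowhere for \<open>k \<le> n\<close>; so the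
  two families have the same wedge products up to a nonzero factor, which gives
  non-degeneracy and adaptedness of the frame (\<open>frenet_curve_has_invariants\<close>).

  Uniqueness: proportional wedge products mean that \<open>E\<^sub>1, \<dots>, E\<^sub>j\<close> and \<open>Z\<^sub>1, \<dots>, Z\<^sub>j\<close> have the same
  orthogonal complement for every \<open>j\<close>.  Differentiating the orthogonality relations of
  the \<open>Z\<^sub>i\<close> shows that every coefficient outside the Frenet pattern vanishes
  (\<open>curve_with_invariants_frenet_frame\<close>).  The frames of two curves with the same
  invariants solve the same system, so one constant unitary map carries one frame to the other.
  It carries the projected curves to each other up to a translation and a global sign, and the last
  coordinates then agree up to a constant because both contact normalities are \<open>\<tau>\<close>
  (\<open>curve_with_invariants_unique\<close>).
\<close>


section \<open>Functions of class \<open>C\<^sup>k\<close>\<close>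

lemma Ck_on_Suc_iff:
  "Ck_on (Suc k) S f \<longleftrightarrow>
     (\<forall>x\<in>S. (f has_derivative frechet_derivative f (at x)) (at x)) \<and>
     (\<forall>v. Ck_on k S (\<lambda>x. frechet_derivative f (at x) v))"
  unfolding Ck_on.simps frechet_derivative_works[symmetric] ..

lemma Ck_on_cong:
  assumes "open S" and "\<And>x. x \<in> S \<Longrightarrow> f x = g x" and "Ck_on k S f"
  shows "Ck_on k S g"
  using assms(2,3)
proof (induction k arbitrary: f g)
  case 0
  then show ?case by (simp cong: continuous_on_cong)
next
  case (Suc k)
  have f: "(f has_derivative frechet_derivative f (at x)) (at x)" if "x \<in> S" for x
    using Suc.prems(2) that unfolding Ck_on_Suc_iff by blast
  have g: "(g has_derivative frechet_derivative f (at x)) (at x)" if "x \<in> S" for x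
    by (rule has_derivative_transform_within_open[OF f[OF that] assms(1) that Suc.prems(1)])
  note eq = frechet_derivative_at[OF g]
  have "Ck_on k S (\<lambda>x. frechet_derivative g (at x) v)" for v
  proof (rule Suc.IH)
    show "Ck_on k S (\<lambda>x. frechet_derivative f (at x) v)"
      using Suc.prems(2) unfolding Ck_on_Suc_iff by blast
    show "frechet_derivative f (at x) v = frechet_derivative g (at x) v" if "x \<in> S" for x
      by (rule fun_cong[OF eq[OF that]])
  qed
  moreover have "(g has_derivative frechet_derivative g (at x)) (at x)" if "x \<in> S" for x
    using g[OF that] unfolding eq[OF that] .
  ultimately show ?case unfolding Ck_on_Suc_iff by blast
qed

lemma Ck_on_Suc_intro:
  assumes "open S" and f: "\<And>x. x \<in> S \<Longrightarrow> (f has_derivative f' x) (at x)"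
    and f': "\<And>v. Ck_on k S (\<lambda>x. f' x v)"
  shows "Ck_on (Suc k) S f"
proof -
  note eq = frechet_derivative_at[OF f]
  have "Ck_on k S (\<lambda>x. frechet_derivative f (at x) v)" for v
    by (rule Ck_on_cong[OF assms(1) _ f'[of v]]) (rule fun_cong[OF eq])
  moreover have "(f has_derivative frechet_derivative f (at x)) (at x)" if "x \<in> S" for x
    using f[OF that] unfolding eq[OF that] .
  ultimately show ?thesis unfolding Ck_on_Suc_iff by blast
qed

lemma Ck_on_Suc_has_derivative:
  assumes "Ck_on (Suc k) S f" "x \<in> S"
  shows "(f has_derivative frechet_derivative f (at x)) (at x)"
  using assms unfolding Ck_on_Suc_iff by blast

lemma Ck_on_decrease: "Ck_on (Suc k) S f \<Longrightarrow> Ck_on k S f"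
proof (induction k arbitrary: f)
  case 0
  then show ?case
    by (auto intro!: continuous_at_imp_continuous_on differentiable_imp_continuous_within)
next
  case (Suc k)
  from Suc.prems have "Ck_on k S (\<lambda>x. frechet_derivative f (at x) v)" for v
    by (intro Suc.IH) simp
  with Suc.prems show ?case by simp
qed

lemma smooth_on_imp_continuous_on: "smooth_on S f \<Longrightarrow> continuous_on S f"
  unfolding smooth_on_def using Ck_on.simps(1) by blast

lemma Ck_on_const: "open S \<Longrightarrow> Ck_on k S (\<lambda>_. c)"
proof (induction k arbitrary: c)
  case (Suc k)
  then show ?case by (intro Ck_on_Suc_intro[where f' = "\<lambda>_ _. 0"]) auto
qed simp

lemma Ck_on_add:
  "open S \<Longrightarrow> Ck_on k S f \<Longrightarrow> Ck_on k S g \<Longrightarrow> Ck_on k S (\<lambda>x. f x + g x)"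
proof (induction k arbitrary: f g)
  case 0
  then show ?case by (auto intro: continuous_intros)
next
  case (Suc k)
  show ?case
    by (rule Ck_on_Suc_intro[OF Suc.prems(1)
          has_derivative_add[OF Ck_on_Suc_has_derivative[OF Suc.prems(2)]
            Ck_on_Suc_has_derivative[OF Suc.prems(3)]]])
       (use Suc in auto)
qed

lemma Ck_on_sum:
  "open S \<Longrightarrow> (\<And>i. i \<in> A \<Longrightarrow> Ck_on k S (f i)) \<Longrightarrow> Ck_on k S (\<lambda>x. \<Sum>i\<in>A. f i x)"
  by (induction A rule: infinite_finite_induct) (auto intro: Ck_on_const Ck_on_add)

lemma Ck_on_bounded_linear:
  assumes "bounded_linear L" "open S"
  shows "Ck_on k S f \<Longrightarrow> Ck_on k S (\<lambda>x. L (f x))"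
proof (induction k arbitrary: f)
  case 0
  then show ?case by (auto intro: bounded_linear.continuous_on[OF assms(1)])
next
  case (Suc k)
  show ?case
    by (rule Ck_on_Suc_intro[OF assms(2) bounded_linear.has_derivative[OF assms(1)
          Ck_on_Suc_has_derivative[OF Suc.prems]]])
       (use Suc in auto)
qed

lemma Ck_on_bounded_bilinear:
  assumes B: "bounded_bilinear B" and "open S"
  shows "Ck_on k S f \<Longrightarrow> Ck_on k S g \<Longrightarrow> Ck_on k S (\<lambda>x. B (f x) (g x))"
proof (induction k arbitrary: f g)
  case 0
  then show ?case by (auto intro: bounded_bilinear.continuous_on[OF B])
next
  case (Suc k)
  show ?case
    by (rule Ck_on_Suc_intro[OF assms(2) bounded_bilinear.FDERIV[OF B
          Ck_on_Suc_has_derivative[OF Suc.prems(1)] Ck_on_Suc_has_derivative[OF Suc.prems(2)]]])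
       (use Suc assms Ck_on_decrease[OF Suc.prems(1)] Ck_on_decrease[OF Suc.prems(2)]
         in \<open>auto intro!: Ck_on_add Suc.IH\<close>)
qed

lemma Ck_on_Pair:
  assumes "open S" "Ck_on k S f" "Ck_on k S g"
  shows "Ck_on k S (\<lambda>x. (f x, g x))"
proof -
  have "Ck_on k S (\<lambda>x. (f x, 0) + (0, g x))"
    using assms
    by (intro Ck_on_add Ck_on_bounded_linear[where L = "\<lambda>x. (x, 0)"]
          Ck_on_bounded_linear[where L = "\<lambda>x. (0, x)"]
          bounded_linear_Pair bounded_linear_ident bounded_linear_zero)
  then show ?thesis by simp
qed

lemma smooth_on_affine:
  assumes "bounded_linear L"
  shows "smooth_on UNIV (\<lambda>x. c + L x)"
proof -
  have "((\<lambda>x. c + L x) has_derivative L) (at x)" for x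
    using bounded_linear_imp_has_derivative[OF assms] by (auto intro!: derivative_eq_intros)
  moreover from this have "continuous_on UNIV (\<lambda>x. c + L x)"
    by (meson continuous_at_imp_continuous_on has_derivative_continuous)
  ultimately have "Ck_on k UNIV (\<lambda>x. c + L x)" for k
    by (cases k; auto simp del: Ck_on.simps(2) intro!: Ck_on_Suc_intro[of UNIV _ "\<lambda>_. L"] Ck_on_const)
  then show ?thesis by (simp add: smooth_on_def)
qed

text \<open>
  For curves the directional derivatives are the multiples of one derivative, so
  differentiability classes can be read off the ordinary derivative.
\<close>

lemma Ck_on_curve_Suc:
  fixes f :: "real \<Rightarrow> 'a::real_normed_vector"
  assumes "open I" "\<And>s. s \<in> I \<Longrightarrow> (f has_vector_derivative f' s) (at s)" "Ck_on k I f'"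
  shows "Ck_on (Suc k) I f"
proof (rule Ck_on_Suc_intro[OF assms(1)])
  show "(f has_derivative (\<lambda>h. h *\<^sub>R f' x)) (at x)" if "x \<in> I" for x
    using assms(2)[OF that] by (simp add: has_vector_derivative_def)
  show "Ck_on k I (\<lambda>x. v *\<^sub>R f' x)" for v
    using Ck_on_bounded_linear[OF bounded_linear_scaleR_right assms(1,3)] .
qed

lemma smooth_on_curve_derivative:
  fixes f :: "real \<Rightarrow> 'a::real_normed_vector"
  assumes "open I" "smooth_on I f"
  shows "\<And>s. s \<in> I \<Longrightarrow> (f has_vector_derivative vector_derivative f (at s)) (at s)"
    and "smooth_on I (\<lambda>s. vector_derivative f (at s))"
proof -
  have C: "Ck_on (Suc k) I f" for k
    using assms(2) by (auto simp: smooth_on_def)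
  show *: "(f has_vector_derivative vector_derivative f (at s)) (at s)" if "s \<in> I" for s
    using C[of 0] that by (simp add: vector_derivative_works)
  have "Ck_on k I (\<lambda>s. vector_derivative f (at s))" for k
  proof (rule Ck_on_cong[OF assms(1)])
    show "Ck_on k I (\<lambda>s. frechet_derivative f (at s) 1)" using C[of k] by simp
    show "frechet_derivative f (at s) 1 = vector_derivative f (at s)" if "s \<in> I" for s
      using frechet_derivative_at[OF *[OF that, unfolded has_vector_derivative_def], symmetric] by simp
  qed
  then show "smooth_on I (\<lambda>s. vector_derivative f (at s))" by (simp add: smooth_on_def)
qed

lemma nth_vector_derivative_Suc:
  "nth_vector_derivative (Suc k) f = (\<lambda>s. vector_derivative (nth_vector_derivative k f) (at s))"
  by (simp add: nth_vector_derivative_def)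

lemma nth_vector_derivative_0 [simp]: "nth_vector_derivative 0 f = f"
  by (simp add: nth_vector_derivative_def)

lemma smooth_on_nth_vector_derivative:
  assumes "open I" "smooth_on I f"
  shows "smooth_on I (nth_vector_derivative k f)"
  by (induction k)
     (auto simp: assms nth_vector_derivative_Suc smooth_on_curve_derivative(2))

lemma has_vector_derivative_nth_vector_derivative:
  assumes "open I" "smooth_on I f" "s \<in> I"
  shows "(nth_vector_derivative k f has_vector_derivative nth_vector_derivative (Suc k) f s) (at s)"
  using smooth_on_curve_derivative(1)[OF assms(1) smooth_on_nth_vector_derivative[OF assms(1,2)] assms(3)]
  by (simp add: nth_vector_derivative_Suc)

text \<open>
  Bootstrapping: if all \<open>y\<^sub>i\<close> are of class \<open>C\<^sup>k\<close>, the right-hand sides are too, hence the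
  \<open>y\<^sub>i\<close> are of class \<open>C\<^sup>k\<^sup>+\<^sup>1\<close>.
\<close>

lemma smooth_on_linear_system:
  fixes y :: "'i \<Rightarrow> real \<Rightarrow> 'a::real_normed_vector"
  assumes "open I"
    and a: "\<And>i j. i \<in> S \<Longrightarrow> j \<in> S \<Longrightarrow> smooth_on I (a i j)"
    and y: "\<And>i s. i \<in> S \<Longrightarrow> s \<in> I \<Longrightarrow> (y i has_vector_derivative (\<Sum>j\<in>S. a i j s *\<^sub>R y j s)) (at s)"
    and "i \<in> S"
  shows "smooth_on I (y i)"
proof -
  have "\<forall>i\<in>S. Ck_on k I (y i)" for k
  proof (induction k)
    case 0
    then show ?case
      using y by (auto intro!: continuous_at_imp_continuous_on has_vector_derivative_continuous)
  next
    case (Suc k)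
    then show ?case
      using a assms(1) unfolding smooth_on_def
      by (intro ballI Ck_on_curve_Suc[OF assms(1) y] Ck_on_sum
           Ck_on_bounded_bilinear[OF bounded_bilinear_scaleR]) auto
  qed
  then show ?thesis using assms(4) by (simp add: smooth_on_def)
qed

lemma has_vector_derivative_inner:
  fixes f g :: "real \<Rightarrow> 'a::real_inner"
  assumes "(f has_vector_derivative f') (at s within A)" "(g has_vector_derivative g') (at s within A)"
  shows "((\<lambda>s. f s \<bullet> g s) has_vector_derivative (f s \<bullet> g' + f' \<bullet> g s)) (at s within A)"
  using bounded_bilinear.has_vector_derivative[OF bounded_bilinear_inner assms] .

text \<open>
  The product rule for a constant inner product.  This is how orthogonality relations along a curve
  are differentiated below.
\<close>

lemma inner_constant_derivative:
  fixes f g :: "real \<Rightarrow> 'a::real_inner"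
  assumes "open I" "s \<in> I" "\<And>s. s \<in> I \<Longrightarrow> f s \<bullet> g s = c"
    and "(f has_vector_derivative f') (at s)" "(g has_vector_derivative g') (at s)"
  shows "f' \<bullet> g s = - (f s \<bullet> g')"
proof -
  have "((\<lambda>s. f s \<bullet> g s) has_vector_derivative 0) (at s)"
    by (rule has_vector_derivative_transform_within_open[OF _ assms(1,2), of "\<lambda>_. c"])
       (use assms(3) in auto)
  then have "0 = f s \<bullet> g' + f' \<bullet> g s"
    using vector_derivative_unique_at[OF _ has_vector_derivative_inner[OF assms(4,5)]] by blast
  then show ?thesis by simp
qed

lemma zero_derivative_imp_constant:
  fixes f :: "real \<Rightarrow> 'a::real_normed_vector"
  assumes "is_interval I" and "\<And>s. s \<in> I \<Longrightarrow> (f has_vector_derivative 0) (at s)"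
  shows "\<exists>c. \<forall>s\<in>I. f s = c"
proof -
  have "(f has_vector_derivative 0) (at s within I)" if "s \<in> I" for s
    using has_vector_derivative_at_within[OF assms(2)[OF that]] .
  from has_vector_derivative_zero_constant[OF is_interval_convex[OF assms(1)] this]
  show ?thesis by blast
qed

section \<open>Wedge products as determinants\<close>

lemma wedge_cong:
  assumes "\<And>a b. a \<in> {1..j} \<Longrightarrow> b \<in> {1..j} \<Longrightarrow> g (v a) (w b) = g' (v' a) (w' b)"
  shows "wedge g j v w = wedge g' j v' w'"
  unfolding wedge_def
  by (intro sum.cong refl arg_cong2[where f = "(*)"] prod.cong assms)
     (auto dest: permutes_in_image)

text \<open>
  A permutation other than the identity sends some \<open>a\<close> to a larger index, and the corresponding
  factor is zero.
\<close>

lemma wedge_lower_triangular: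
  assumes "\<And>a b. a \<in> {1..j} \<Longrightarrow> b \<in> {1..j} \<Longrightarrow> a < b \<Longrightarrow> g (v a) (w b) = 0"
  shows "wedge g j v w = (\<Prod>a\<in>{1..j}. g (v a) (w a))"
proof -
  have "of_int (sign p) * (\<Prod>a\<in>{1..j}. g (v a) (w (p a))) = 0"
    if "p \<in> {p. p permutes {1..j}} - {id}" for p
  proof -
    from that have p: "p permutes {1..j}" "p \<noteq> id" by auto
    then obtain a where "a \<in> {1..j}" "a < p a"
      using permutes_natset_le[OF p(1)] by (meson not_le_imp_less)
    then have "g (v a) (w (p a)) = 0"
      using assms permutes_in_image[OF p(1)] by blast
    with \<open>a \<in> {1..j}\<close> show ?thesis by (auto intro!: bexI[of _ a])
  qed
  then have "wedge g j v w = (\<Sum>p\<in>{id}. of_int (sign p) * (\<Prod>a\<in>{1..j}. g (v a) (w (p a))))"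
    unfolding wedge_def by (intro sum.mono_neutral_right) (auto simp: finite_permutations permutes_id)
  then show ?thesis by simp
qed

lemma wedge_sym:
  assumes "\<And>x y. g x y = g y x"
  shows "wedge g j v w = wedge g j w v"
proof -
  have "wedge g j v w = (\<Sum>p | p permutes {1..j}. of_int (sign (inv p)) * (\<Prod>a\<in>{1..j}. g (v a) (w (inv p a))))"
    unfolding wedge_def by (subst sum_permutations_inverse) simp
  also have "\<dots> = wedge g j w v"
    unfolding wedge_def
  proof (intro sum.cong refl arg_cong2[where f = "(*)"])
    fix p assume "p \<in> {p. p permutes {1..j}}"
    then have p: "p permutes {1..j}" by simp
    show "real_of_int (sign (inv p)) = real_of_int (sign p)"
      using p by (simp add: sign_inverse permutation_permutes)
       (metis finite_atLeastAtMost permutation_permutes sign_inverse)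
    have "(\<Prod>a\<in>{1..j}. g (v a) (w (inv p a))) = (\<Prod>a\<in>{1..j}. g (v (p a)) (w (inv p (p a))))"
      using prod.permute[OF p, of "\<lambda>a. g (v a) (w (inv p a))"] by (simp add: o_def)
    also have "\<dots> = (\<Prod>a\<in>{1..j}. g (w a) (v (p a)))"
      using permutes_inverses[OF p] assms by simp
    finally show "(\<Prod>a\<in>{1..j}. g (v a) (w (inv p a))) = (\<Prod>a\<in>{1..j}. g (w a) (v (p a)))" .
  qed
  finally show ?thesis .
qed

text \<open>
  Composing the summation index with the transposition of the two equal rows flips every sign
  and changes nothing else, so the sum equals its own negative.
\<close>

lemma wedge_repeated:
  assumes "b \<in> {1..j}" "c \<in> {1..j}" "b \<noteq> c" "v b = v c"
  shows "wedge g j v w = 0"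
proof -
  let ?t = "Transposition.transpose b c"
  have t: "?t permutes {1..j}" using assms by (simp add: permutes_swap_id)
  have "wedge g j v w = (\<Sum>p | p permutes {1..j}. of_int (sign (p \<circ> ?t)) * (\<Prod>a\<in>{1..j}. g (v a) (w ((p \<circ> ?t) a))))"
    unfolding wedge_def by (subst sum_permutations_compose_right[OF t]) simp
  also have "\<dots> = (\<Sum>p | p permutes {1..j}. - (of_int (sign p) * (\<Prod>a\<in>{1..j}. g (v a) (w (p a)))))"
  proof (intro sum.cong refl)
    fix p assume "p \<in> {p. p permutes {1..j}}"
    then have p: "permutation p" by (auto simp: permutation_permutes)
    have s: "sign (p \<circ> ?t) = - sign p"
      using assms(3) by (simp add: sign_compose[OF p] permutation_swap_id sign_swap_id)
    have "(\<Prod>a\<in>{1..j}. g (v a) (w ((p \<circ> ?t) a))) = (\<Prod>a\<in>{1..j}. g (v (?t a)) (w ((p \<circ> ?t) (?t a))))"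
      using prod.permute[OF t, of "\<lambda>a. g (v a) (w ((p \<circ> ?t) a))"] by (simp add: o_def)
    also have "\<dots> = (\<Prod>a\<in>{1..j}. g (v a) (w (p a)))"
    proof (intro prod.cong refl)
      fix a
      have "v (?t a) = v a" using assms(4) by (cases "a = b"; cases "a = c") auto
      then show "g (v (?t a)) (w ((p \<circ> ?t) (?t a))) = g (v a) (w (p a))" by simp
    qed
    finally show "of_int (sign (p \<circ> ?t)) * (\<Prod>a\<in>{1..j}. g (v a) (w ((p \<circ> ?t) a)))
        = - (of_int (sign p) * (\<Prod>a\<in>{1..j}. g (v a) (w (p a))))"
      using s by simp
  qed
  also have "\<dots> = - wedge g j v w" by (simp add: wedge_def sum_negf)
  finally show ?thesis by simp
qed

lemma wedge_row_sum:
  assumes b: "b \<in> {1..j}" and g: "\<And>y. g x y = (\<Sum>i\<in>A. c i * g (u i) y)"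
  shows "wedge g j (v(b := x)) w = (\<Sum>i\<in>A. c i * wedge g j (v(b := u i)) w)"
proof -
  have split: "(\<Prod>a\<in>{1..j}. g ((v(b := z)) a) (w (p a))) = g z (w (p b)) * (\<Prod>a\<in>{1..j} - {b}. g (v a) (w (p a)))" for z p
  proof -
    have "(\<Prod>a\<in>{1..j} - {b}. g ((v(b := z)) a) (w (p a))) = (\<Prod>a\<in>{1..j} - {b}. g (v a) (w (p a)))"
      by (intro prod.cong) auto
    then show ?thesis
      using prod.remove[OF finite_atLeastAtMost b, of "\<lambda>a. g ((v(b := z)) a) (w (p a))"]
      by (simp only: fun_upd_same)
  qed
  let ?R = "\<lambda>p. \<Prod>a\<in>{1..j} - {b}. g (v a) (w (p a))"
  have "wedge g j (v(b := x)) w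
      = (\<Sum>p | p permutes {1..j}. \<Sum>i\<in>A. c i * (of_int (sign p) * (g (u i) (w (p b)) * ?R p)))"
    unfolding wedge_def split
  proof (intro sum.cong refl)
    fix p
    show "of_int (sign p) * (g x (w (p b)) * ?R p)
        = (\<Sum>i\<in>A. c i * (of_int (sign p) * (g (u i) (w (p b)) * ?R p)))"
      unfolding g[of "w (p b)"] sum_distrib_right sum_distrib_left by (simp only: mult_ac)
  qed
  also have "\<dots> = (\<Sum>i\<in>A. \<Sum>p | p permutes {1..j}. c i * (of_int (sign p) * (g (u i) (w (p b)) * ?R p)))"
    by (rule sum.swap)
  also have "\<dots> = (\<Sum>i\<in>A. c i * wedge g j (v(b := u i)) w)"
    unfolding wedge_def split sum_distrib_left ..
  finally show ?thesis .
qed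

text \<open>
  The change of basis is made one row at a time, through the mixed families
  \<open>e\<^sub>1, \<dots>, e\<^sub>k, z\<^sub>k\<^sub>+\<^sub>1, \<dots>, z\<^sub>j\<close>.  When \<open>z\<^sub>k\<close> is expanded in the family where
  \<open>e\<^sub>1, \<dots>, e\<^sub>k\<^sub>-\<^sub>1\<close> are already in place, only the multiple of \<open>e\<^sub>k\<close> survives.
\<close>

lemma wedge_triangular_combination:
  assumes z: "\<And>a y. a \<in> {1..j} \<Longrightarrow> g (z a) y = (\<Sum>b\<in>{1..a}. c a b * g (e b) y)"
  shows "wedge g j z w = (\<Prod>a\<in>{1..j}. c a a) * wedge g j e w"
proof -
  define mix where "mix k = (\<lambda>a. if a \<le> k then e a else z a)" for k :: nat
  have "wedge g j (mix 0) w = (\<Prod>a\<in>{1..k}. c a a) * wedge g j (mix k) w" if "k \<le> j" for k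
    using that
  proof (induction k)
    case (Suc k)
    have up: "mix k = (mix (Suc k))(Suc k := z (Suc k))"
      by (rule ext) (simp add: mix_def le_Suc_eq)
    have "wedge g j (mix k) w
       = (\<Sum>b\<in>{1..Suc k}. c (Suc k) b * wedge g j ((mix (Suc k))(Suc k := e b)) w)"
      unfolding up
    proof (rule wedge_row_sum)
      show "Suc k \<in> {1..j}" using Suc.prems by simp
      then show "g (z (Suc k)) y = (\<Sum>b\<in>{1..Suc k}. c (Suc k) b * g (e b) y)" for y by (rule z)
    qed
    also have "\<dots> = (\<Sum>b\<in>{1..Suc k}. if b = Suc k then c (Suc k) (Suc k) * wedge g j (mix (Suc k)) w else 0)"
    proof (intro sum.cong refl)
      fix b assume b: "b \<in> {1..Suc k}"
      show "c (Suc k) b * wedge g j ((mix (Suc k))(Suc k := e b)) w =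
          (if b = Suc k then c (Suc k) (Suc k) * wedge g j (mix (Suc k)) w else 0)"
      proof (cases "b = Suc k")
        case True
        then have "(mix (Suc k))(Suc k := e b) = mix (Suc k)" by (auto simp: mix_def)
        with True show ?thesis by simp
      next
        case False
        then have "wedge g j ((mix (Suc k))(Suc k := e b)) w = 0"
          using b Suc.prems by (intro wedge_repeated[of b j "Suc k"]) (auto simp: mix_def)
        with False show ?thesis by simp
      qed
    qed
    also have "\<dots> = c (Suc k) (Suc k) * wedge g j (mix (Suc k)) w" by simp
    finally show ?case using Suc by simp
  qed simp
  from this[of j] have "wedge g j (mix 0) w = (\<Prod>a\<in>{1..j}. c a a) * wedge g j (mix j) w" by simp
  moreover have "wedge g j (mix 0) w = wedge g j z w" "wedge g j (mix j) w = wedge g j e w"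
    by (auto intro!: wedge_cong simp: mix_def)
  ultimately show ?thesis by simp
qed

section \<open>Linear differential systems on an open interval\<close>

text \<open>
  The interval may be unbounded, so its end points are taken in the extended reals.
\<close>

lemma antiderivative_open_interval:
  fixes f :: "real \<Rightarrow> 'a::euclidean_space"
  assumes I: "open I" "is_interval I" "t0 \<in> I" and f: "continuous_on I f"
  shows "\<exists>F. F t0 = 0 \<and> (\<forall>t\<in>I. (F has_vector_derivative f t) (at t))"
proof -
  define a b where "a = (INF x\<in>I. ereal x)" and "b = (SUP x\<in>I. ereal x)"
  have I_iff: "x \<in> I \<longleftrightarrow> a < ereal x \<and> ereal x < b" for x
  proof
    assume "x \<in> I"
    then obtain d where d: "d > 0" "cball x d \<subseteq> I"
      using I(1) open_contains_cball by blast
    then have "x - d \<in> I" "x + d \<in> I" by (auto simp: dist_real_def subset_eq)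
    then have "a \<le> ereal (x - d)" "ereal (x + d) \<le> b"
      unfolding a_def b_def by (auto intro: INF_lower SUP_upper)
    moreover have "ereal (x - d) < ereal x" "ereal x < ereal (x + d)" using d by auto
    ultimately show "a < ereal x \<and> ereal x < b" by (meson le_less_trans less_le_trans)
  next
    assume "a < ereal x \<and> ereal x < b"
    then obtain y z where "y \<in> I" "z \<in> I" "y < x" "x < z"
      unfolding a_def b_def by (auto simp: INF_less_iff less_SUP_iff)
    then show "x \<in> I" using I(2) unfolding is_interval_1 by (meson less_imp_le)
  qed
  have "a < b" using I_iff[of t0] I(3) by (meson less_trans)
  moreover have "isCont f x" if "a < ereal x" "ereal x < b" for x
    using that f I(1) I_iff continuous_on_eq_continuous_at by blast
  ultimately obtain F where F: "\<forall>x. a < ereal x \<longrightarrow> ereal x < b \<longrightarrow> (F has_vector_derivative f x) (at x)"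
    using einterval_antiderivative by blast
  show ?thesis
    using F I_iff by (intro exI[of _ "\<lambda>t. F t - F t0"]) (auto intro!: derivative_eq_intros)
qed

definition antiderivative_from :: "real set \<Rightarrow> real \<Rightarrow> (real \<Rightarrow> 'a::euclidean_space) \<Rightarrow> real \<Rightarrow> 'a" where
  "antiderivative_from I t0 f =
     (SOME F. F t0 = 0 \<and> (\<forall>t\<in>I. (F has_vector_derivative f t) (at t)))"

lemma antiderivative_from:
  fixes f :: "real \<Rightarrow> 'a::euclidean_space"
  assumes "open I" "is_interval I" "t0 \<in> I" "continuous_on I f"
  shows "antiderivative_from I t0 f t0 = 0"
    and "t \<in> I \<Longrightarrow> (antiderivative_from I t0 f has_vector_derivative f t) (at t)"
  using someI_ex[OF antiderivative_open_interval[OF assms]]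
  unfolding antiderivative_from_def by blast+

text \<open>
  Solving \<open>y' = a y\<close>, \<open>y(t\<^sub>0) = c\<close> by successive integration gives \<open>y\<close> as the sum of these terms; the
  partial sums are the Picard iterates.
\<close>

primrec picard_term :: "real set \<Rightarrow> real \<Rightarrow> 'i set \<Rightarrow> ('i \<Rightarrow> 'i \<Rightarrow> real \<Rightarrow> real) \<Rightarrow>
    ('i \<Rightarrow> 'a::euclidean_space) \<Rightarrow> nat \<Rightarrow> 'i \<Rightarrow> real \<Rightarrow> 'a" where
  "picard_term I t0 S a c 0 = (\<lambda>i t. c i)"
| "picard_term I t0 S a c (Suc k) =
     (\<lambda>i. antiderivative_from I t0 (\<lambda>t. \<Sum>j\<in>S. a i j t *\<^sub>R picard_term I t0 S a c k j t))"

locale linear_system =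
  fixes I :: "real set" and t0 :: real and S :: "'i set"
    and a :: "'i \<Rightarrow> 'i \<Rightarrow> real \<Rightarrow> real" and c :: "'i \<Rightarrow> 'a::euclidean_space"
  assumes I: "open I" "is_interval I" "t0 \<in> I" and S: "finite S"
    and a: "\<And>i j. i \<in> S \<Longrightarrow> j \<in> S \<Longrightarrow> continuous_on I (a i j)"
begin

abbreviation "u \<equiv> picard_term I t0 S a c"

lemma continuous_picard_term: "i \<in> S \<Longrightarrow> continuous_on I (u k i)"
proof (induction k arbitrary: i)
  case (Suc k)
  have "continuous_on I (\<lambda>t. \<Sum>j\<in>S. a i j t *\<^sub>R u k j t)"
    using Suc a by (intro continuous_intros) auto
  then show ?case
    using antiderivative_from(2)[OF I]
    by (auto intro!: continuous_at_imp_continuous_on has_vector_derivative_continuous)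
qed simp

lemma continuous_picard_rhs: "i \<in> S \<Longrightarrow> continuous_on I (\<lambda>t. \<Sum>j\<in>S. a i j t *\<^sub>R u k j t)"
  using continuous_picard_term a by (intro continuous_intros) auto

lemma picard_term_at_start: "i \<in> S \<Longrightarrow> u (Suc k) i t0 = 0"
  using antiderivative_from(1)[OF I continuous_picard_rhs] by simp

lemma picard_term_derivative:
  "i \<in> S \<Longrightarrow> t \<in> I \<Longrightarrow> (u (Suc k) i has_vector_derivative (\<Sum>j\<in>S. a i j t *\<^sub>R u k j t)) (at t)"
  using antiderivative_from(2)[OF I continuous_picard_rhs] by simp

lemma picard_rhs_bound:
  assumes "\<And>j. j \<in> S \<Longrightarrow> norm (u k j t) \<le> B" "(\<Sum>j\<in>S. \<bar>a i j t\<bar>) \<le> M" "B \<ge> 0"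
  shows "norm (\<Sum>j\<in>S. a i j t *\<^sub>R u k j t) \<le> M * B"
proof -
  have "norm (\<Sum>j\<in>S. a i j t *\<^sub>R u k j t) \<le> (\<Sum>j\<in>S. \<bar>a i j t\<bar> * B)"
    using assms by (intro sum_norm_le) (auto intro!: mult_left_mono)
  also have "\<dots> \<le> M * B" using assms by (simp flip: sum_distrib_right add: mult_right_mono)
  finally show ?thesis .
qed

text \<open>
  Measured against the weight \<open>exp (2 M \<bar>t - t\<^sub>0\<bar>)\<close>, where \<open>M\<close> bounds the matrix, each integration
  gains a factor \<open>1/2\<close>: integrating \<open>M\<close> times the weight gives at most half the weight.
  This makes the series converge geometrically on a compact interval of any length.
\<close>

lemma picard_term_bound:
  assumes K: "{l..r} \<subseteq> I" "t0 \<in> {l..r}" and M: "M \<ge> 0"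
    "\<And>i t. i \<in> S \<Longrightarrow> t \<in> {l..r} \<Longrightarrow> (\<Sum>j\<in>S. \<bar>a i j t\<bar>) \<le> M"
    and C: "C \<ge> 0" "\<And>i. i \<in> S \<Longrightarrow> norm (c i) \<le> C"
  shows "i \<in> S \<Longrightarrow> t \<in> {l..r} \<Longrightarrow> norm (u k i t) \<le> C * (1/2)^k * exp (2 * M * \<bar>t - t0\<bar>)"
proof (induction k arbitrary: i t)
  case 0
  have "C * 1 \<le> C * exp (2 * M * \<bar>t - t0\<bar>)" using C M by (intro mult_left_mono) auto
  with C 0 show ?case by (auto intro: order_trans)
next
  case (Suc k)
  define D where "D s = (\<Sum>j\<in>S. a i j s *\<^sub>R u k j s)" for s
  have D: "norm (D s) \<le> M * (C * (1/2)^k * exp (2 * M * \<bar>s - t0\<bar>))" if "s \<in> {l..r}" for s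
    unfolding D_def using Suc.IH M Suc.prems C that by (intro picard_rhs_bound) auto
  have cont: "continuous_on {p..q} (u (Suc k) i)" if "l \<le> p" "q \<le> r" for p q
    by (rule continuous_on_subset[OF continuous_picard_term]) (use Suc.prems K that in auto)
  have deriv: "(u (Suc k) i has_vector_derivative D s) (at s)" if "s \<in> {l..r}" for s
    unfolding D_def using picard_term_derivative[OF Suc.prems(1)] K that by blast
  have start: "u (Suc k) i t0 = 0" using picard_term_at_start Suc.prems by blast
  let ?A = "C * (1/2)^(Suc k)"
  consider "t = t0" | "t0 < t" | "t < t0" by linarith
  then show ?case
  proof cases
    case 1
    then show ?thesis using C start by simp
  next
    case 2
    have "norm (u (Suc k) i t - u (Suc k) i t0)
        \<le> ?A * exp (2 * M * (t - t0)) - ?A * exp (2 * M * (t0 - t0))"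
    proof (rule differentiable_bound_general[OF 2, where f' = D
          and \<phi>' = "\<lambda>s. ?A * (exp (2 * M * (s - t0)) * (2 * M))"])
      show "((\<lambda>s. ?A * exp (2 * M * (s - t0))) has_vector_derivative
          ?A * (exp (2 * M * (s - t0)) * (2 * M))) (at s)" for s
        unfolding has_real_derivative_iff_has_vector_derivative[symmetric]
        by (auto intro!: derivative_eq_intros)
      show "norm (D s) \<le> ?A * (exp (2 * M * (s - t0)) * (2 * M))" if "t0 < s" "s < t" for s
        using D[of s] that Suc.prems K by (auto simp: mult_ac)
    qed (use 2 K Suc.prems cont deriv in \<open>auto intro!: continuous_intros\<close>)
    then show ?thesis using 2 C start by (simp add: algebra_simps)
      (smt (verit, ccfv_SIG) zero_le_mult_iff zero_le_power zero_le_divide_1_iff)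
  next
    case 3
    have "norm (u (Suc k) i t0 - u (Suc k) i t)
        \<le> (- ?A * exp (2 * M * (t0 - t0))) - (- ?A * exp (2 * M * (t0 - t)))"
    proof (rule differentiable_bound_general[OF 3, where f' = D
          and \<phi>' = "\<lambda>s. ?A * (exp (2 * M * (t0 - s)) * (2 * M))"])
      show "((\<lambda>s. - ?A * exp (2 * M * (t0 - s))) has_vector_derivative
          ?A * (exp (2 * M * (t0 - s)) * (2 * M))) (at s)" for s
        unfolding has_real_derivative_iff_has_vector_derivative[symmetric]
        by (auto intro!: derivative_eq_intros)
      show "norm (D s) \<le> ?A * (exp (2 * M * (t0 - s)) * (2 * M))" if "t < s" "s < t0" for s
        using D[of s] that Suc.prems K by (auto simp: mult_ac)
    qed (use 3 K Suc.prems cont deriv in \<open>auto intro!: continuous_intros\<close>)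
    then show ?thesis using 3 C start by (simp add: algebra_simps)
      (smt (verit, ccfv_SIG) zero_le_mult_iff zero_le_power zero_le_divide_1_iff)
  qed
qed

text \<open>
  Both the series and the series of derivatives converge uniformly on a compact interval around \<open>t\<^sub>0\<close>
  and \<open>t\<close>, so the sum may be differentiated term by term.
\<close>

lemma picard_series_derivative:
  assumes i: "i \<in> S" and t: "t \<in> I"
  shows "((\<lambda>t. \<Sum>k. u k i t) has_vector_derivative (\<Sum>j\<in>S. a i j t *\<^sub>R (\<Sum>k. u k j t))) (at t)"
proof -
  obtain d where d: "d > 0" "cball t d \<subseteq> I" "cball t0 d \<subseteq> I"
  proof -
    obtain d1 d2 where "d1 > 0" "cball t d1 \<subseteq> I" "d2 > 0" "cball t0 d2 \<subseteq> I"
      using I t open_contains_cball by metis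
    then show ?thesis by (intro that[of "min d1 d2"]) auto
  qed
  define l r where "l = min t t0 - d" and "r = max t t0 + d"
  have "l \<in> cball t d \<union> cball t0 d" "r \<in> cball t d \<union> cball t0 d"
    using d(1) by (cases "t \<le> t0"; simp add: l_def r_def dist_real_def)+
  then have lr: "l \<in> I" "r \<in> I" using d by blast+
  then have K: "{l..r} \<subseteq> I"
    by (intro subsetI) (rule mem_is_interval_1_I[OF I(2), of l r], auto)
  have in_K: "t0 \<in> {l..r}" "t \<in> {l<..<r}" using d by (auto simp: l_def r_def)
  have "\<exists>B. \<forall>i\<in>S. \<forall>t\<in>{l..r}. (\<Sum>j\<in>S. \<bar>a i j t\<bar>) \<le> B"
  proof -
    have "continuous_on {l..r} (\<lambda>t. \<Sum>i\<in>S. \<Sum>j\<in>S. \<bar>a i j t\<bar>)"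
      using a by (intro continuous_intros continuous_on_subset[OF _ K]) auto
    then have "bounded ((\<lambda>t. \<Sum>i\<in>S. \<Sum>j\<in>S. \<bar>a i j t\<bar>) ` {l..r})"
      by (intro compact_imp_bounded compact_continuous_image) auto
    then obtain B where B: "\<forall>t\<in>{l..r}. \<bar>\<Sum>i\<in>S. \<Sum>j\<in>S. \<bar>a i j t\<bar>\<bar> \<le> B"
      unfolding bounded_iff by auto
    have "(\<Sum>j\<in>S. \<bar>a i j t\<bar>) \<le> B" if "i \<in> S" "t \<in> {l..r}" for i t
    proof -
      have "(\<Sum>j\<in>S. \<bar>a i j t\<bar>) \<le> (\<Sum>i\<in>S. \<Sum>j\<in>S. \<bar>a i j t\<bar>)"
        using that S by (intro member_le_sum) (auto intro: sum_nonneg)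
      with bspec[OF B that(2)] show ?thesis by linarith
    qed
    then show ?thesis by blast
  qed
  then obtain B where B: "\<And>i t. i \<in> S \<Longrightarrow> t \<in> {l..r} \<Longrightarrow> (\<Sum>j\<in>S. \<bar>a i j t\<bar>) \<le> B" by blast
  define M where "M = max B 0"
  have M: "M \<ge> 0" "\<And>i t. i \<in> S \<Longrightarrow> t \<in> {l..r} \<Longrightarrow> (\<Sum>j\<in>S. \<bar>a i j t\<bar>) \<le> M"
    using B by (auto simp: M_def le_max_iff_disj)
  define C where "C = (\<Sum>i\<in>S. norm (c i))"
  have C: "C \<ge> 0" "\<And>i. i \<in> S \<Longrightarrow> norm (c i) \<le> C"
    unfolding C_def using S by (auto intro: sum_nonneg member_le_sum)
  define E where "E = C * exp (2 * M * (r - l))"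
  have E: "E \<ge> 0" using C by (simp add: E_def)
  have u_bound: "norm (u k j s) \<le> E * (1/2)^k" if "j \<in> S" "s \<in> {l..r}" for k j s
  proof -
    have "exp (2 * M * \<bar>s - t0\<bar>) \<le> exp (2 * M * (r - l))"
      using M that in_K by (auto intro!: mult_left_mono)
    then have "C * (1/2)^k * exp (2 * M * \<bar>s - t0\<bar>) \<le> C * (1/2)^k * exp (2 * M * (r - l))"
      using C by (intro mult_left_mono) auto
    with picard_term_bound[OF K in_K(1) M C that, of k] show ?thesis by (simp add: E_def mult_ac)
  qed
  have summ: "summable (\<lambda>k. u k j s)" if "j \<in> S" "s \<in> {l..r}" for j s
    by (rule summable_comparison_test'[OF _ u_bound[OF that]]) (simp add: summable_geometric summable_mult)
  \<comment> \<open>Derivatives of the terms; the constant term \<open>u 0\<close> contributes zero.\<close>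
  define D where "D k s = (case k of 0 \<Rightarrow> 0 | Suc k \<Rightarrow> \<Sum>j\<in>S. a i j s *\<^sub>R u k j s)" for k s
  define G where "G s = (\<Sum>j\<in>S. a i j s *\<^sub>R (\<Sum>k. u k j s))" for s
  have D_bound: "norm (D k s) \<le> 2 * M * E * (1/2)^k" if "s \<in> {l..r}" for k s
  proof (cases k)
    case 0
    then show ?thesis using M E by (simp add: D_def)
  next
    case (Suc k')
    have "norm (D k s) \<le> M * (E * (1/2)^k')"
      unfolding D_def Suc using that M i E u_bound by (simp, intro picard_rhs_bound) auto
    then show ?thesis using Suc by simp
  qed
  have D_sum: "(\<Sum>k. D k s) = G s" if "s \<in> {l..r}" for s
  proof -
    have "(\<lambda>k. \<Sum>j\<in>S. a i j s *\<^sub>R u k j s) sums G s"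
      unfolding G_def using summ[OF _ that]
      by (intro sums_sum sums_scaleR_right summable_sums) auto
    then have "(\<lambda>k. D (Suc k) s) sums G s" by (simp add: D_def)
    then have "(\<lambda>k. D k s) sums (G s + D 0 s)" by (rule sums_Suc)
    then show ?thesis by (simp add: D_def sums_iff)
  qed
  have unif: "uniform_limit {l..r} (\<lambda>n s. \<Sum>k<n. D k s) G sequentially"
  proof -
    have "uniform_limit {l..r} (\<lambda>n s. \<Sum>k<n. D k s) (\<lambda>s. \<Sum>k. D k s) sequentially"
      by (rule Weierstrass_m_test[OF D_bound]) (auto simp: summable_geometric summable_mult)
    then show ?thesis
      by (rule uniform_limit_cong'[THEN iffD1, rotated -1]) (auto simp: D_sum)
  qed
  have "\<exists>g. \<forall>s\<in>{l..r}. (\<lambda>k. u k i s) sums (g s) \<and> (g has_derivative (\<lambda>h. h *\<^sub>R G s)) (at s within {l..r})"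
  proof (rule has_derivative_series[where f' = "\<lambda>k s h. h *\<^sub>R D k s" and x = t and l = "\<Sum>k. u k i t"])
    show "(u k i has_derivative (\<lambda>h. h *\<^sub>R D k s)) (at s within {l..r})" if "s \<in> {l..r}" for k s
    proof (cases k)
      case (Suc k')
      have "(u (Suc k') i has_vector_derivative (\<Sum>j\<in>S. a i j s *\<^sub>R u k' j s)) (at s within {l..r})"
        using has_vector_derivative_at_within[OF picard_term_derivative[OF i]] that K by blast
      then show ?thesis unfolding has_vector_derivative_def D_def Suc by simp
    qed (simp add: D_def)
    show "\<forall>\<^sub>F n in sequentially. \<forall>s\<in>{l..r}. \<forall>h. norm ((\<Sum>k<n. h *\<^sub>R D k s) - h *\<^sub>R G s) \<le> e * norm h"
      if "e > 0" for e
      using uniform_limitD[OF unif that]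
    proof eventually_elim
      case (elim n)
      show ?case
      proof (intro ballI allI)
        fix s h assume "s \<in> {l..r}"
        then have "norm ((\<Sum>k<n. D k s) - G s) \<le> e" using elim by (auto simp: dist_norm less_imp_le)
        then have "\<bar>h\<bar> * norm ((\<Sum>k<n. D k s) - G s) \<le> \<bar>h\<bar> * e" by (intro mult_left_mono) auto
        then show "norm ((\<Sum>k<n. h *\<^sub>R D k s) - h *\<^sub>R G s) \<le> e * norm h"
          by (simp add: mult_ac flip: scaleR_sum_right scaleR_diff_right)
      qed
    qed
    show "(\<lambda>k. u k i t) sums (\<Sum>k. u k i t)" using summ[OF i] in_K by (intro summable_sums) auto
  qed (use in_K in auto)
  then obtain g where g: "\<And>s. s \<in> {l..r} \<Longrightarrow> (\<lambda>k. u k i s) sums (g s)"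
    "\<And>s. s \<in> {l..r} \<Longrightarrow> (g has_derivative (\<lambda>h. h *\<^sub>R G s)) (at s within {l..r})"
    by blast
  have "(g has_derivative (\<lambda>h. h *\<^sub>R G t)) (at t)"
    using g(2)[of t] in_K(2) at_within_interior[of t "{l..r}"] by (simp add: interior_atLeastAtMost_real)
  then have "((\<lambda>t. \<Sum>k. u k i t) has_derivative (\<lambda>h. h *\<^sub>R G t)) (at t)"
    by (rule has_derivative_transform_within_open[OF _ open_greaterThanLessThan in_K(2)])
       (use g(1) in \<open>auto simp: sums_iff\<close>)
  then show ?thesis by (simp add: has_vector_derivative_def G_def)
qed

lemma picard_series_at_start: "i \<in> S \<Longrightarrow> (\<Sum>k. u k i t0) = c i"
proof -
  assume i: "i \<in> S"
  have "(\<Sum>k. u k i t0) = (\<Sum>k\<in>{0}. u k i t0)"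
  proof (rule suminf_finite)
    fix k :: nat assume "k \<notin> {0}"
    then obtain m where "k = Suc m" by (auto simp: gr0_conv_Suc)
    then show "u k i t0 = 0" using picard_term_at_start[OF i] by blast
  qed simp
  then show ?thesis by simp
qed

end

lemma linear_system_has_solution:
  fixes c :: "'i \<Rightarrow> 'a::euclidean_space"
  assumes "open I" "is_interval I" "t0 \<in> I" "finite S"
    and "\<And>i j. i \<in> S \<Longrightarrow> j \<in> S \<Longrightarrow> continuous_on I (a i j)"
  obtains y where "\<And>i. i \<in> S \<Longrightarrow> y i t0 = c i"
    and "\<And>i t. i \<in> S \<Longrightarrow> t \<in> I \<Longrightarrow> (y i has_vector_derivative (\<Sum>j\<in>S. a i j t *\<^sub>R y j t)) (at t)"
proof -
  interpret linear_system I t0 S a c by unfold_locales (use assms in auto)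
  show ?thesis
    by (rule that[of "\<lambda>i t. \<Sum>k. u k i t"]) (auto simp: picard_series_at_start picard_series_derivative)
qed

lemma sum_skew_symmetric_eq_0:
  fixes b q :: "'i \<Rightarrow> 'i \<Rightarrow> real"
  assumes "\<And>i j. i \<in> S \<Longrightarrow> j \<in> S \<Longrightarrow> b i j = - b j i"
    and "\<And>i j. i \<in> S \<Longrightarrow> j \<in> S \<Longrightarrow> q i j = q j i"
  shows "(\<Sum>i\<in>S. \<Sum>j\<in>S. b i j * q i j) = 0"
proof -
  have "(\<Sum>i\<in>S. \<Sum>j\<in>S. b i j * q i j) = (\<Sum>i\<in>S. \<Sum>j\<in>S. b j i * q j i)" by (rule sum.swap)
  also have "\<dots> = (\<Sum>i\<in>S. \<Sum>j\<in>S. - (b i j * q i j))"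
  proof (intro sum.cong refl)
    fix i j assume "i \<in> S" "j \<in> S"
    then show "b j i * q j i = - (b i j * q i j)" using assms(1)[of j i] assms(2)[of j i] by simp
  qed
  also have "\<dots> = - (\<Sum>i\<in>S. \<Sum>j\<in>S. b i j * q i j)" by (simp add: sum_negf)
  finally show ?thesis by simp
qed

text \<open>
  The energy \<open>\<Sum>\<^sub>i \<bar>y\<^sub>i\<bar>\<^sup>2\<close> has derivative \<open>2 \<Sum>\<^sub>i\<^sub>j a\<^sub>i\<^sub>j \<langle>y\<^sub>i, y\<^sub>j\<rangle>\<close>, a skew matrix paired with a symmetric one.
  So it is constant, and it is zero at \<open>t\<^sub>0\<close>.
\<close>

lemma skew_system_zero:
  fixes y :: "'i \<Rightarrow> real \<Rightarrow> 'a::real_inner"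
  assumes I: "is_interval I" "t0 \<in> I" and S: "finite S"
    and skew: "\<And>i j t. i \<in> S \<Longrightarrow> j \<in> S \<Longrightarrow> t \<in> I \<Longrightarrow> a i j t = - a j i t"
    and y: "\<And>i t. i \<in> S \<Longrightarrow> t \<in> I \<Longrightarrow> (y i has_vector_derivative (\<Sum>j\<in>S. a i j t *\<^sub>R y j t)) (at t)"
    and "\<And>i. i \<in> S \<Longrightarrow> y i t0 = 0" and i: "i \<in> S" "t \<in> I"
  shows "y i t = 0"
proof -
  let ?E = "\<lambda>t. \<Sum>i\<in>S. y i t \<bullet> y i t"
  have "(?E has_vector_derivative 0) (at t within I)" if "t \<in> I" for t
  proof -
    have "((\<lambda>t. y i t \<bullet> y i t) has_derivative (\<lambda>h. y i t \<bullet> (h *\<^sub>R (\<Sum>j\<in>S. a i j t *\<^sub>R y j t))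
        + (h *\<^sub>R (\<Sum>j\<in>S. a i j t *\<^sub>R y j t)) \<bullet> y i t)) (at t within I)" if "i \<in> S" for i
    proof -
      have "(y i has_derivative (\<lambda>h. h *\<^sub>R (\<Sum>j\<in>S. a i j t *\<^sub>R y j t))) (at t within I)"
        using has_derivative_at_withinI[OF y[OF that \<open>t \<in> I\<close>, unfolded has_vector_derivative_def]] .
      from has_derivative_inner[OF this this] show ?thesis .
    qed
    then have "(?E has_derivative (\<lambda>h. \<Sum>i\<in>S. y i t \<bullet> (h *\<^sub>R (\<Sum>j\<in>S. a i j t *\<^sub>R y j t))
        + (h *\<^sub>R (\<Sum>j\<in>S. a i j t *\<^sub>R y j t)) \<bullet> y i t)) (at t within I)"
      by (rule has_derivative_sum)
    moreover have "(\<Sum>i\<in>S. y i t \<bullet> (h *\<^sub>R (\<Sum>j\<in>S. a i j t *\<^sub>R y j t))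
        + (h *\<^sub>R (\<Sum>j\<in>S. a i j t *\<^sub>R y j t)) \<bullet> y i t) = 0" for h
    proof -
      have "y i t \<bullet> (h *\<^sub>R (\<Sum>j\<in>S. a i j t *\<^sub>R y j t)) + (h *\<^sub>R (\<Sum>j\<in>S. a i j t *\<^sub>R y j t)) \<bullet> y i t
            = 2 * h * (\<Sum>j\<in>S. a i j t * (y i t \<bullet> y j t))" for i
      proof -
        have "y i t \<bullet> (\<Sum>j\<in>S. a i j t *\<^sub>R y j t) = (\<Sum>j\<in>S. a i j t * (y i t \<bullet> y j t))"
          by (simp add: inner_sum_right)
        then show ?thesis by (simp add: inner_commute)
      qed
      then have "(\<Sum>i\<in>S. y i t \<bullet> (h *\<^sub>R (\<Sum>j\<in>S. a i j t *\<^sub>R y j t))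
        + (h *\<^sub>R (\<Sum>j\<in>S. a i j t *\<^sub>R y j t)) \<bullet> y i t)
        = 2 * h * (\<Sum>i\<in>S. \<Sum>j\<in>S. a i j t * (y i t \<bullet> y j t))"
        by (simp only: sum_distrib_left[symmetric])
      also have "(\<Sum>i\<in>S. \<Sum>j\<in>S. a i j t * (y i t \<bullet> y j t)) = 0"
        by (rule sum_skew_symmetric_eq_0) (auto intro: skew \<open>t \<in> I\<close> inner_commute)
      finally show ?thesis by simp
    qed
    ultimately show ?thesis by (simp add: has_vector_derivative_def)
  qed
  then obtain C where C: "\<And>t. t \<in> I \<Longrightarrow> ?E t = C"
    using has_vector_derivative_zero_constant[of I ?E] I(1) is_interval_convex by blast
  have "?E t = ?E t0" using C i(2) I(2) by simp
  also have "\<dots> = 0" using assms(6) by simp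
  finally show ?thesis using i S by (simp add: sum_nonneg_eq_0_iff)
qed

lemma skew_system_unique:
  fixes y z :: "'i \<Rightarrow> real \<Rightarrow> 'a::real_inner"
  assumes I: "is_interval I" "t0 \<in> I" and S: "finite S"
    and skew: "\<And>i j t. i \<in> S \<Longrightarrow> j \<in> S \<Longrightarrow> t \<in> I \<Longrightarrow> a i j t = - a j i t"
    and y: "\<And>i t. i \<in> S \<Longrightarrow> t \<in> I \<Longrightarrow> (y i has_vector_derivative (\<Sum>j\<in>S. a i j t *\<^sub>R y j t)) (at t)"
    and z: "\<And>i t. i \<in> S \<Longrightarrow> t \<in> I \<Longrightarrow> (z i has_vector_derivative (\<Sum>j\<in>S. a i j t *\<^sub>R z j t)) (at t)"
    and start: "\<And>i. i \<in> S \<Longrightarrow> y i t0 = z i t0" and "i \<in> S" "t \<in> I"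
  shows "y i t = z i t"
proof -
  have D: "((\<lambda>t. y i t - z i t) has_vector_derivative (\<Sum>j\<in>S. a i j t *\<^sub>R (y j t - z j t))) (at t)"
    if "i \<in> S" "t \<in> I" for i t
    using has_vector_derivative_diff[OF y[OF that] z[OF that]]
    by (simp add: sum_subtractf[symmetric] scaleR_diff_right)
  have "y i t - z i t = 0"
    by (rule skew_system_zero[where a = a and y = "\<lambda>i t. y i t - z i t", OF I S skew D _ assms(8,9)])
       (simp_all add: start)
  then show ?thesis by simp
qed

text \<open>
  The deviation \<open>h\<^sub>i\<^sub>k = \<langle>y\<^sub>i, y\<^sub>k\<rangle> - \<delta>\<^sub>i\<^sub>k\<close> of the Gram matrix satisfies
  \<open>h' = a h - h a\<close>, since \<open>a\<close> is skew.  As a system indexed by pairs this is again skew, so \<open>h\<close>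
  stays zero.
\<close>

lemma skew_system_orthonormal:
  fixes y :: "'i \<Rightarrow> real \<Rightarrow> 'a::real_inner"
  assumes I: "is_interval I" "t0 \<in> I" and S: "finite S"
    and skew: "\<And>i j t. i \<in> S \<Longrightarrow> j \<in> S \<Longrightarrow> t \<in> I \<Longrightarrow> a i j t = - a j i t"
    and y: "\<And>i t. i \<in> S \<Longrightarrow> t \<in> I \<Longrightarrow> (y i has_vector_derivative (\<Sum>j\<in>S. a i j t *\<^sub>R y j t)) (at t)"
    and start: "\<And>i j. i \<in> S \<Longrightarrow> j \<in> S \<Longrightarrow> y i t0 \<bullet> y j t0 = (if i = j then 1 else 0)"
    and ij: "i \<in> S" "j \<in> S" "t \<in> I"
  shows "y i t \<bullet> y j t = (if i = j then 1 else 0)"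
proof -
  define A where "A = (\<lambda>(i, k) (j, l) t. (if k = l then a i j t else 0) + (if i = j then a k l t else 0))"
  define h where "h = (\<lambda>(i, k) t. y i t \<bullet> y k t - (if i = k then 1 else 0 :: real))"
  have "h (i, j) t = 0"
  proof (rule skew_system_zero[of I t0 "S \<times> S" A h])
    show "A p q t = - A q p t" if "p \<in> S \<times> S" "q \<in> S \<times> S" "t \<in> I" for p q t
    proof -
      obtain i k j l where pq: "p = (i, k)" "q = (j, l)" "i \<in> S" "k \<in> S" "j \<in> S" "l \<in> S"
        using \<open>p \<in> S \<times> S\<close> \<open>q \<in> S \<times> S\<close> by auto
      show ?thesis
        using skew[OF pq(3,5) \<open>t \<in> I\<close>] skew[OF pq(4,6) \<open>t \<in> I\<close>]
        unfolding A_def pq split by (cases "k = l"; cases "i = j"; simp)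
    qed
    show "h p t0 = 0" if "p \<in> S \<times> S" for p using that start by (auto simp: h_def)
    show "(h p has_vector_derivative (\<Sum>q\<in>S \<times> S. A p q t *\<^sub>R h q t)) (at t)"
      if "p \<in> S \<times> S" "t \<in> I" for p t
    proof -
      obtain i k where p: "p = (i, k)" "i \<in> S" "k \<in> S" using \<open>p \<in> S \<times> S\<close> by auto
      note yD = y[OF _ that(2), unfolded has_vector_derivative_def]
      have "(h p has_derivative (\<lambda>x. y i t \<bullet> (x *\<^sub>R (\<Sum>j\<in>S. a k j t *\<^sub>R y j t))
          + (x *\<^sub>R (\<Sum>j\<in>S. a i j t *\<^sub>R y j t)) \<bullet> y k t - 0)) (at t)"
        unfolding h_def p split
        by (rule has_derivative_diff[OF has_derivative_inner[OF yD[OF p(2)] yD[OF p(3)]] has_derivative_const])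
      moreover have "(\<Sum>q\<in>S \<times> S. A p q t *\<^sub>R h q t)
          = y i t \<bullet> (\<Sum>j\<in>S. a k j t *\<^sub>R y j t) + (\<Sum>j\<in>S. a i j t *\<^sub>R y j t) \<bullet> y k t"
      proof -
        have "(\<Sum>q\<in>S \<times> S. A p q t *\<^sub>R h q t) = (\<Sum>j\<in>S. \<Sum>l\<in>S. A (i, k) (j, l) t * h (j, l) t)"
          by (simp add: sum.cartesian_product p split_beta')
        also have "\<dots> = (\<Sum>j\<in>S. \<Sum>l\<in>S. (if k = l then a i j t * h (j, l) t else 0))
            + (\<Sum>j\<in>S. \<Sum>l\<in>S. (if i = j then a k l t * h (j, l) t else 0))"
          by (simp add: A_def sum.distrib[symmetric] distrib_right if_distrib[of "\<lambda>x. x * _"] cong: if_cong)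
        also have "(\<Sum>j\<in>S. \<Sum>l\<in>S. (if k = l then a i j t * h (j, l) t else 0)) = (\<Sum>j\<in>S. a i j t * h (j, k) t)"
          using p S by simp
        also have "(\<Sum>j\<in>S. \<Sum>l\<in>S. (if i = j then a k l t * h (j, l) t else 0)) = (\<Sum>l\<in>S. a k l t * h (i, l) t)"
          using p S by (subst sum.swap) simp
        also have "(\<Sum>j\<in>S. a i j t * h (j, k) t) = (\<Sum>j\<in>S. a i j t *\<^sub>R y j t) \<bullet> y k t - a i k t"
          using p S by (simp add: h_def right_diff_distrib sum_subtractf inner_sum_left
              if_distrib[of "\<lambda>x. _ * x"] cong: if_cong)
        also have "(\<Sum>l\<in>S. a k l t * h (i, l) t) = y i t \<bullet> (\<Sum>j\<in>S. a k j t *\<^sub>R y j t) - a k i t"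
          using p S by (simp add: h_def right_diff_distrib sum_subtractf inner_sum_right
              if_distrib[of "\<lambda>x. _ * x"] cong: if_cong)
        finally show ?thesis using skew[OF p(2,3) that(2)] by linarith
      qed
      ultimately show ?thesis by (simp add: has_vector_derivative_def algebra_simps)
    qed
  qed (use I S ij in auto)
  then show ?thesis by (simp add: h_def)
qed

section \<open>The projection of the Heisenberg group to complex space\<close>

type_synonym 'n plane = "(real ^ 'n) \<times> (real ^ 'n)"

definition proj :: "'n::finite heis \<Rightarrow> 'n plane" where
  "proj v = (fst v, fst (snd v))"

definition rot :: "'n::finite plane \<Rightarrow> 'n plane" where
  "rot u = (- snd u, fst u)"

text \<open>
  The horizontal lift: the contact vector at \<open>p\<close> that projects to \<open>u\<close>.
\<close>

definition lift_at :: "'n::finite heis \<Rightarrow> 'n plane \<Rightarrow> 'n heis" where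
  "lift_at p u = (fst u, snd u, - (rot (proj p) \<bullet> u))"

lemma rot_rot [simp]: "rot (rot u) = - u"
  by (simp add: rot_def prod_eq_iff)

lemma inner_rot_rot [simp]: "rot u \<bullet> rot v = u \<bullet> v"
  by (simp add: rot_def inner_prod_def)

lemma inner_rot_left: "rot u \<bullet> v = - (u \<bullet> rot v)"
  by (simp add: rot_def inner_prod_def)

lemma bounded_linear_proj: "bounded_linear proj"
  unfolding proj_def
  by (intro bounded_linear_Pair bounded_linear_fst bounded_linear_fst_comp bounded_linear_snd)

lemma bounded_linear_rot: "bounded_linear rot"
  unfolding rot_def
  by (intro bounded_linear_Pair bounded_linear_minus bounded_linear_fst bounded_linear_snd)

lemma proj_zero [simp]: "proj 0 = 0"
  by (simp add: proj_def zero_prod_def)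

lemma linear_lift_at: "linear (lift_at p)"
  by (rule linearI) (simp_all add: lift_at_def inner_add_right)

lemma proj_lift_at [simp]: "proj (lift_at p u) = u"
  by (simp add: proj_def lift_at_def)

text \<open>
  Since \<open>\<langle>rot (x, y), (a, b)\<rangle> = x \<bullet> b - y \<bullet> a\<close>, the contact form is \<open>dz\<close> plus the one-form
  \<open>\<langle>rot u, du\<rangle>\<close> of \<open>\<complex>\<^sup>n\<close>, and written like this the latter is visibly invariant under unitary maps.
\<close>

lemma contact_form_eq: "contact_form p v = snd (snd v) + rot (proj p) \<bullet> proj v"
  by (simp add: contact_form_def rot_def proj_def inner_prod_def inner_vec_def sum_subtractf sum_negf)

lemma contact_form_0: "contact_form p 0 = 0"
  by (simp add: contact_form_eq)

lemma contact_form_add: "contact_form p (v + w) = contact_form p v + contact_form p w"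
  by (simp add: contact_form_eq linear_add[OF bounded_linear.linear[OF bounded_linear_proj]] inner_add_right)

lemma contact_form_scaleR: "contact_form p (r *\<^sub>R v) = r * contact_form p v"
  by (simp add: contact_form_eq linear_scale[OF bounded_linear.linear[OF bounded_linear_proj]] distrib_left)

lemma contact_form_lift_at [simp]: "contact_form p (lift_at p u) = 0"
  by (simp add: contact_form_eq) (simp add: lift_at_def)

text \<open>
  The two arguments are the coordinates of a vector in the frame of left invariant fields: the horizontal
  ones and the one along \<open>e_T\<close>.
\<close>

lemma tangent_vector_eqI:
  assumes "proj v = proj w" "contact_form p v = contact_form p w"
  shows "v = w"
  using assms by (simp add: contact_form_eq) (simp add: proj_def prod_eq_iff)

lemma lift_at_proj: "contact_form p v = 0 \<Longrightarrow> lift_at p (proj v) = v"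
  by (rule tangent_vector_eqI[of _ _ p]) simp_all

lemma sum_axis: "(\<Sum>j\<in>UNIV. a $ j *\<^sub>R axis j 1) = (a :: real ^ 'n::finite)"
  using basis_expansion[of a] by (simp add: scalar_mult_eq_scaleR)

lemma horizontal_part_eq: "horizontal_part p v = lift_at p (proj v)"
proof (rule prod_eqI)
  show "fst (horizontal_part p v) = fst (lift_at p (proj v))"
    by (simp add: horizontal_part_def fst_sum e_x_def e_y_def lift_at_def proj_def sum_axis)
  show "snd (horizontal_part p v) = snd (lift_at p (proj v))"
    by (rule prod_eqI)
       (simp_all add: horizontal_part_def fst_sum snd_sum e_x_def e_y_def lift_at_def proj_def
         sum_axis rot_def inner_prod_def inner_vec_def sum_subtractf sum_negf mult_ac)
qed

lemma J_eq: "J p v = lift_at p (rot (proj v))"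
proof (rule prod_eqI)
  show "fst (J p v) = fst (lift_at p (rot (proj v)))"
    by (simp add: J_def fst_sum e_x_def e_y_def lift_at_def proj_def rot_def sum_negf sum_axis)
  show "snd (J p v) = snd (lift_at p (rot (proj v)))"
    by (rule prod_eqI)
       (simp_all add: J_def fst_sum snd_sum e_x_def e_y_def lift_at_def proj_def
         sum_axis rot_def inner_prod_def inner_vec_def sum_subtractf sum_negf mult_ac)
qed

lemma levi_eq: "levi p v w = proj v \<bullet> proj w + contact_form p v * contact_form p w"
  by (simp add: levi_def proj_def inner_prod_def inner_vec_def sum.distrib)

lemma has_contact_normality_iff:
  fixes \<gamma> :: "real \<Rightarrow> 'n::finite heis"
  shows "has_contact_normality I \<gamma> \<tau> \<longleftrightarrow>
     (\<forall>s\<in>I. contact_form (\<gamma> s) (vector_derivative \<gamma> (at s)) = \<tau> s)"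
proof -
  have "proj (e_T :: 'n heis) = 0" "\<And>p. contact_form p (e_T :: 'n::finite heis) = 1"
    by (simp_all add: proj_def e_T_def contact_form_eq zero_prod_def[symmetric])
  then show ?thesis unfolding has_contact_normality_def by (simp add: levi_eq)
qed

lemma contact_space_eq: "contact_space p = range (lift_at p)"
proof
  have "e_x p j = lift_at p (axis j 1, 0)" "e_y p j = lift_at p (0, axis j 1)" for j
    by (simp_all add: e_x_def e_y_def lift_at_def rot_def proj_def inner_prod_def inner_axis inner_axis')
  moreover have "subspace (range (lift_at p))"
    using linear_subspace_image[OF linear_lift_at subspace_UNIV] .
  ultimately show "contact_space p \<subseteq> range (lift_at p)"
    unfolding contact_space_def by (intro span_minimal) auto
  show "range (lift_at p) \<subseteq> contact_space p"
  proof
    fix v assume "v \<in> range (lift_at p)"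
    then obtain u where "v = horizontal_part p (fst u, snd u, 0)"
      by (auto simp: horizontal_part_eq proj_def)
    moreover have "e_x p j \<in> contact_space p" "e_y p j \<in> contact_space p" for j
      unfolding contact_space_def by (auto intro: span_base)
    ultimately show "v \<in> contact_space p"
      unfolding horizontal_part_def contact_space_def
      by (simp only: span_sum span_add span_scale)
  qed
qed

lemma mem_contact_space_iff: "v \<in> contact_space p \<longleftrightarrow> contact_form p v = 0"
  unfolding contact_space_eq using lift_at_proj[of p v] by (metis contact_form_lift_at imageE rangeI)

section \<open>Rigid motions\<close>

text \<open>
  The linear map \<open>(u, z) \<mapsto> (V u, z)\<close> followed by the left translation by \<open>(c, d)\<close>.
\<close>

definition rigid_motion :: "('n::finite plane \<Rightarrow> 'n plane) \<Rightarrow> 'n plane \<Rightarrow> real \<Rightarrow> 'n heis \<Rightarrow> 'n heis" where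
  "rigid_motion V c d p =
     (fst (V (proj p) + c), snd (V (proj p) + c), snd (snd p) + d - rot c \<bullet> V (proj p))"

lemma proj_rigid_motion: "proj (rigid_motion V c d p) = V (proj p) + c"
  by (simp add: rigid_motion_def proj_def prod_eq_iff)

text \<open>
  The map is affine with linear part \<open>L\<close>, so it is smooth and its derivative is \<open>L\<close> everywhere.  The
  translation is built to preserve the contact form, and \<open>V\<close> preserves its part
  \<open>\<langle>rot u, du\<rangle>\<close> because it is an isometry that commutes with \<open>rot\<close>.  Everything else follows, even
  injectivity of \<open>L\<close>: a vector in the kernel has zero projection and zero contact form.
\<close>

lemma rigid_motion_in_PSH:
  fixes V :: "'n::finite plane \<Rightarrow> 'n plane"
  assumes V: "linear V" and isometry: "\<And>u v. V u \<bullet> V v = u \<bullet> v"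
    and rot: "\<And>u. V (rot u) = rot (V u)"
  shows "rigid_motion V c d \<in> PSH"
proof -
  let ?\<Phi> = "rigid_motion V c d"
  define \<Phi>\<^sub>0 where "\<Phi>\<^sub>0 = (fst c, snd c, d)"
  define L where "L v = (fst (V (proj v)), snd (V (proj v)), snd (snd v) - rot c \<bullet> V (proj v))" for v
  have \<Phi>: "?\<Phi> p = \<Phi>\<^sub>0 + L p" for p
    by (simp add: rigid_motion_def \<Phi>\<^sub>0_def L_def)
  note proj_linear = bounded_linear.linear[OF bounded_linear_proj]
  have "linear L"
    by (rule linearI)
       (simp_all add: L_def linear_add[OF proj_linear] linear_add[OF V] linear_scale[OF proj_linear]
         linear_scale[OF V] inner_add_right right_diff_distrib)
  then have L: "bounded_linear L" by (simp add: linear_conv_bounded_linear)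
  have proj_L: "proj (L v) = V (proj v)" for v by (simp add: L_def proj_def)
  have contact: "contact_form (?\<Phi> p) (L v) = contact_form p v" for p v
  proof -
    have "contact_form (?\<Phi> p) (L v) = snd (snd v) + rot (V (proj p)) \<bullet> V (proj v)"
      unfolding contact_form_eq proj_L proj_rigid_motion
      by (simp add: L_def linear_add[OF bounded_linear.linear[OF bounded_linear_rot]] inner_add_left)
    also have "\<dots> = contact_form p v"
      unfolding rot[symmetric] isometry contact_form_eq ..
    finally show ?thesis .
  qed
  have "inj L"
    unfolding linear_injective_0[OF \<open>linear L\<close>]
  proof (intro allI impI)
    fix v assume "L v = 0"
    then have "V (proj v) = 0" using proj_L[of v] by simp
    then have "proj v = 0" using isometry[of "proj v" "proj v"] by simp
    moreover have "contact_form 0 v = 0"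
      using contact[of 0 v] \<open>L v = 0\<close> by (simp add: contact_form_eq)
    ultimately show "v = 0"
      by (intro tangent_vector_eqI[of v 0 0]) (simp_all add: contact_form_eq)
  qed
  then have "surj L" using linear_injective_imp_surjective[OF \<open>linear L\<close>] by blast
  have inv_L: "bounded_linear (inv L)"
    using inj_linear_imp_inv_linear[OF \<open>linear L\<close> \<open>inj L\<close>] by (simp add: linear_conv_bounded_linear)
  have inverse1: "- inv L \<Phi>\<^sub>0 + inv L (?\<Phi> p) = p" for p
    unfolding \<Phi> using linear_add[OF bounded_linear.linear[OF inv_L]] \<open>inj L\<close> by simp
  have inverse2: "?\<Phi> (- inv L \<Phi>\<^sub>0 + inv L q) = q" for q
    unfolding \<Phi> linear_add[OF \<open>linear L\<close>] linear_neg[OF \<open>linear L\<close>]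
    using \<open>surj L\<close> by (simp add: surj_f_inv_f)
  have bij: "bij ?\<Phi>"
    by (rule o_bij[of "\<lambda>q. - inv L \<Phi>\<^sub>0 + inv L q"]) (use inverse1 inverse2 in \<open>auto simp: fun_eq_iff\<close>)
  have inv: "inv ?\<Phi> = (\<lambda>q. - inv L \<Phi>\<^sub>0 + inv L q)"
    by (rule inv_equality) (use inverse1 inverse2 in auto)
  have "(?\<Phi> has_derivative L) (at p)" for p
    unfolding \<Phi>[abs_def] using bounded_linear_imp_has_derivative[OF L]
    by (auto intro!: derivative_eq_intros)
  then have derivative: "frechet_derivative ?\<Phi> (at p) = L" for p
    using frechet_derivative_at by metis
  have "L ` contact_space p = contact_space (?\<Phi> p)" for p
  proof
    show "L ` contact_space p \<subseteq> contact_space (?\<Phi> p)"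
      by (auto simp: mem_contact_space_iff contact)
    show "contact_space (?\<Phi> p) \<subseteq> L ` contact_space p"
    proof
      fix w assume w: "w \<in> contact_space (?\<Phi> p)"
      obtain v where "w = L v" using \<open>surj L\<close> by (elim surjE)
      with w show "w \<in> L ` contact_space p" by (auto simp: mem_contact_space_iff contact)
    qed
  qed
  moreover have "L (J p v) = J (?\<Phi> p) (L v)" for p v
    by (rule tangent_vector_eqI[of _ _ "?\<Phi> p"]) (simp_all add: contact proj_L J_eq rot)
  moreover have "smooth_on UNIV ?\<Phi>"
    unfolding \<Phi>[abs_def] by (rule smooth_on_affine[OF L])
  moreover have "smooth_on UNIV (inv ?\<Phi>)"
    unfolding inv by (rule smooth_on_affine[OF inv_L])
  ultimately show ?thesis
    unfolding PSH_def mem_Collect_eq derivative using bij contact by blast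
qed

section \<open>The Frenet matrix and unitary frames\<close>

text \<open>
  The Frenet matrix of a curve in Euclidean space.
\<close>

definition chain :: "(nat \<Rightarrow> real \<Rightarrow> real) \<Rightarrow> nat \<Rightarrow> nat \<Rightarrow> real \<Rightarrow> real" where
  "chain \<kappa> i j s = (if j = Suc i then \<kappa> i s else if i = Suc j then - \<kappa> j s else 0)"

text \<open>
  In \<open>n \<times> n\<close> blocks this is \<open>(chain, q; -q, chain)\<close>, where the only nonzero entry of \<open>q\<close> is \<open>\<kappa>\<^sub>n\<close> in
  the last place.  It is the real form of the skew-Hermitian matrix \<open>chain + \<i> q\<close>.
\<close>

definition frenet :: "nat \<Rightarrow> (nat \<Rightarrow> real \<Rightarrow> real) \<Rightarrow> nat \<Rightarrow> nat \<Rightarrow> real \<Rightarrow> real" where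
  "frenet n \<kappa> i j s =
     (if i \<le> n
      then (if j \<le> n then chain \<kappa> i j s else if i = n \<and> j = 2 * n then \<kappa> n s else 0)
      else (if j \<le> n then if i = 2 * n \<and> j = n then - \<kappa> n s else 0
            else chain \<kappa> (i - n) (j - n) s))"

lemma chain_skew: "chain \<kappa> i j s = - chain \<kappa> j i s"
  by (cases "j = Suc i") (simp_all add: chain_def)

lemma frenet_skew: "frenet n \<kappa> i j s = - frenet n \<kappa> j i s"
proof (cases "(i \<le> n) = (j \<le> n)")
  case True
  then show ?thesis
    using chain_skew[of \<kappa> i j s] chain_skew[of \<kappa> "i - n" "j - n" s]
    unfolding frenet_def by presburger
next
  case False
  then show ?thesis unfolding frenet_def by (cases "i \<le> n") simp_all
qed

text \<open>
  In a basis with \<open>E\<^sub>n\<^sub>+\<^sub>j = rot E\<^sub>j\<close>, \<open>rot\<close> permutes the vectors up to sign: it sends \<open>E\<^sub>i\<close> to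
  \<open>partner_sign n i\<close> times the vector with index \<open>partner n i\<close>.
\<close>

definition partner :: "nat \<Rightarrow> nat \<Rightarrow> nat" where
  "partner n i = (if i \<le> n then i + n else i - n)"

definition partner_sign :: "nat \<Rightarrow> nat \<Rightarrow> real" where
  "partner_sign n i = (if i \<le> n then 1 else -1)"

text \<open>
  The matrix commutes with \<open>rot\<close>, which is what makes it complex linear.
\<close>

lemma frenet_partner:
  assumes "i \<in> {1..2*n}" "j \<in> {1..2*n}"
  shows "partner_sign n i * partner_sign n j * frenet n \<kappa> (partner n i) (partner n j) s = frenet n \<kappa> i j s"
proof -
  have eq: "i \<le> n \<Longrightarrow> \<not> i + n \<le> n" "j \<le> n \<Longrightarrow> \<not> j + n \<le> n"
    "\<not> i \<le> n \<Longrightarrow> i - n \<le> n" "\<not> j \<le> n \<Longrightarrow> j - n \<le> n"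
    "i + n = 2 * n \<longleftrightarrow> i = n" "j + n = 2 * n \<longleftrightarrow> j = n"
    "\<not> i \<le> n \<Longrightarrow> i - n = n \<longleftrightarrow> i = 2 * n" "\<not> j \<le> n \<Longrightarrow> j - n = n \<longleftrightarrow> j = 2 * n"
    using assms by auto
  show ?thesis
    unfolding frenet_def partner_def partner_sign_def
    by (cases "i \<le> n"; cases "j \<le> n") (simp_all only: eq if_True if_False simp_thms, simp_all)
qed

lemma partner_in: "i \<in> {1..2*n} \<Longrightarrow> partner n i \<in> {1..2*n}"
  by (auto simp: partner_def)

lemma partner_partner: "i \<in> {1..2*n} \<Longrightarrow> partner n (partner n i) = i"
  by (auto simp: partner_def)

lemma partner_sign_partner: "i \<in> {1..2*n} \<Longrightarrow> partner_sign n (partner n i) = - partner_sign n i"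
  by (auto simp: partner_def partner_sign_def)

lemma partner_sign_square [simp]: "partner_sign n i * partner_sign n i = 1"
  by (simp add: partner_sign_def)

lemma smooth_on_uminus:
  assumes "open S" "smooth_on S f"
  shows "smooth_on S (\<lambda>x. - f x)"
  using assms(2) Ck_on_bounded_linear[OF bounded_linear_minus[OF bounded_linear_ident] assms(1)]
  unfolding smooth_on_def by blast

lemma smooth_on_chain:
  assumes "open I" and \<kappa>: "\<And>j. j \<in> {1..n} \<Longrightarrow> smooth_on I (\<kappa> j)" and ij: "i \<in> {1..n}" "j \<in> {1..n}"
  shows "smooth_on I (chain \<kappa> i j)"
proof -
  have "chain \<kappa> i j = (if j = Suc i then \<kappa> i else if i = Suc j then (\<lambda>s. - \<kappa> j s) else (\<lambda>s. 0))"
    by (rule ext) (simp only: chain_def split: if_split, blast)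
  moreover have "smooth_on I (\<lambda>s. 0 :: real)" using assms(1) by (simp add: smooth_on_def Ck_on_const)
  ultimately show ?thesis
    using \<kappa>[OF ij(1)] smooth_on_uminus[OF assms(1) \<kappa>[OF ij(2)]] by presburger
qed

lemma smooth_on_frenet:
  assumes "open I" "\<And>j. j \<in> {1..n} \<Longrightarrow> smooth_on I (\<kappa> j)" "i \<in> {1..2*n}" "j \<in> {1..2*n}"
  shows "smooth_on I (frenet n \<kappa> i j)"
proof -
  have "n \<in> {1..n}" using assms(3) by auto
  note \<kappa>n = assms(2)[OF this]
  have zero: "smooth_on I (\<lambda>s. 0 :: real)" using assms(1) by (simp add: smooth_on_def Ck_on_const)
  consider "i \<le> n \<and> j \<le> n" | "n < i \<and> n < j" | "(i \<le> n) \<noteq> (j \<le> n)" by linarith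
  then show ?thesis
  proof cases
    case 1
    then have "frenet n \<kappa> i j = chain \<kappa> i j" by (simp add: frenet_def fun_eq_iff)
    moreover have "smooth_on I (chain \<kappa> i j)"
      by (rule smooth_on_chain[OF assms(1,2)]) (use 1 assms(3,4) in auto)
    ultimately show ?thesis by simp
  next
    case 2
    then have "frenet n \<kappa> i j = chain \<kappa> (i - n) (j - n)" by (simp add: frenet_def fun_eq_iff)
    moreover have "smooth_on I (chain \<kappa> (i - n) (j - n))"
      by (rule smooth_on_chain[OF assms(1,2)]) (use 2 assms(3,4) in auto)
    ultimately show ?thesis by simp
  next
    case 3
    then have "frenet n \<kappa> i j = (if i \<le> n then if i = n \<and> j = 2 * n then \<kappa> n else (\<lambda>s. 0)
        else if i = 2 * n \<and> j = n then (\<lambda>s. - \<kappa> n s) else (\<lambda>s. 0))"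
      by (intro ext) (simp only: frenet_def split: if_split, blast)
    then show ?thesis using \<kappa>n zero smooth_on_uminus[OF assms(1) \<kappa>n] by presburger
  qed
qed

text \<open>
  A unitary basis \<open>E\<^sub>1, \<dots>, E\<^sub>n\<close> of \<open>\<complex>\<^sup>n\<close>, listed together with the vectors \<open>\<i> E\<^sub>j\<close> as a real
  orthonormal basis.
\<close>

definition unitary_frame :: "(nat \<Rightarrow> 'n::finite plane) \<Rightarrow> bool" where
  "unitary_frame E \<longleftrightarrow>
     (\<forall>i\<in>{1..2 * CARD('n)}. \<forall>k\<in>{1..2 * CARD('n)}. E i \<bullet> E k = (if i = k then 1 else 0))
     \<and> (\<forall>j\<in>{1..CARD('n)}. E (CARD('n) + j) = rot (E j))"

lemma unitary_frame_inner:
  fixes E :: "nat \<Rightarrow> 'n::finite plane"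
  assumes "unitary_frame E" "i \<in> {1..2 * CARD('n)}" "k \<in> {1..2 * CARD('n)}"
  shows "E i \<bullet> E k = (if i = k then 1 else 0)"
  using assms unfolding unitary_frame_def by blast

lemma unitary_frame_rot:
  fixes E :: "nat \<Rightarrow> 'n::finite plane"
  assumes "unitary_frame E" "i \<in> {1..2 * CARD('n)}"
  shows "rot (E i) = partner_sign CARD('n) i *\<^sub>R E (partner CARD('n) i)"
proof (cases "i \<le> CARD('n)")
  case True
  with assms show ?thesis by (simp add: unitary_frame_def partner_def partner_sign_def add.commute)
next
  case False
  then have "i - CARD('n) \<in> {1..CARD('n)}" using assms(2) by auto
  then have "E (CARD('n) + (i - CARD('n))) = rot (E (i - CARD('n)))"
    using assms(1) unfolding unitary_frame_def by blast
  with False show ?thesis by (simp add: partner_def partner_sign_def)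
qed

lemma span_unitary_frame:
  fixes E :: "nat \<Rightarrow> 'n::finite plane"
  assumes "unitary_frame E"
  shows "span (E ` {1..2 * CARD('n)}) = UNIV"
proof -
  let ?S = "{1..2 * CARD('n)}"
  note inner = unitary_frame_inner[OF assms]
  have "inj_on E ?S"
  proof (rule inj_onI)
    fix i k assume ik: "i \<in> ?S" "k \<in> ?S" "E i = E k"
    then have "E i \<bullet> E k = 1" using inner[OF ik(1,1)] by simp
    then show "i = k" using inner[OF ik(1,2)] by (simp split: if_splits)
  qed
  then have "card (E ` ?S) = dim (UNIV :: 'n plane set)" by (simp add: card_image)
  moreover have "independent (E ` ?S)"
  proof (rule pairwise_orthogonal_independent)
    show "pairwise orthogonal (E ` ?S)"
      unfolding pairwise_def orthogonal_def by (auto simp: inner split: if_splits)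
    show "0 \<notin> E ` ?S"
    proof
      assume "0 \<in> E ` ?S"
      then obtain i where "i \<in> ?S" "E i = 0" by force
      then show False using inner[of i i] by simp
    qed
  qed
  ultimately show ?thesis using card_eq_dim[of "E ` ?S" UNIV] by auto
qed

lemma unitary_frame_eq_0:
  fixes E :: "nat \<Rightarrow> 'n::finite plane"
  assumes "unitary_frame E" and u: "\<And>i. i \<in> {1..2 * CARD('n)} \<Longrightarrow> u \<bullet> E i = 0"
  shows "u = 0"
proof -
  have "u \<in> span (E ` {1..2 * CARD('n)})" using span_unitary_frame[OF assms(1)] by simp
  then have "orthogonal u u"
    by (rule orthogonal_to_span) (use u in \<open>auto simp: orthogonal_def\<close>)
  then show ?thesis by (simp add: orthogonal_def)
qed

lemma unitary_frame_expansion: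
  fixes E :: "nat \<Rightarrow> 'n::finite plane"
  assumes "unitary_frame E"
  shows "(\<Sum>i\<in>{1..2 * CARD('n)}. (u \<bullet> E i) *\<^sub>R E i) = u"
proof -
  have "u - (\<Sum>i\<in>{1..2 * CARD('n)}. (u \<bullet> E i) *\<^sub>R E i) = 0"
  proof (rule unitary_frame_eq_0[OF assms])
    fix k assume k: "k \<in> {1..2 * CARD('n)}"
    have "(\<Sum>i\<in>{1..2 * CARD('n)}. (u \<bullet> E i) *\<^sub>R E i) \<bullet> E k
        = (\<Sum>i\<in>{1..2 * CARD('n)}. if i = k then u \<bullet> E k else 0)"
      unfolding inner_sum_left
      by (intro sum.cong refl) (use k in \<open>auto simp: unitary_frame_inner[OF assms]\<close>)
    also have "\<dots> = u \<bullet> E k" using k by simp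
    finally show "(u - (\<Sum>i\<in>{1..2 * CARD('n)}. (u \<bullet> E i) *\<^sub>R E i)) \<bullet> E k = 0"
      by (simp add: inner_diff_left)
  qed
  then show ?thesis by simp
qed

text \<open>
  The map between two unitary frames is an isometry by Parseval's identity.  It commutes with \<open>rot\<close>
  because \<open>rot\<close> acts on both frames by the same signed permutation.
\<close>

lemma unitary_frame_change:
  fixes E F :: "nat \<Rightarrow> 'n::finite plane"
  assumes E: "unitary_frame E" and F: "unitary_frame F"
  defines "V \<equiv> \<lambda>u. \<Sum>i\<in>{1..2 * CARD('n)}. (u \<bullet> E i) *\<^sub>R F i"
  shows "linear V" and "V u \<bullet> V v = u \<bullet> v" and "V (rot u) = rot (V u)"
    and "i \<in> {1..2 * CARD('n)} \<Longrightarrow> V (E i) = F i"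
proof -
  let ?S = "{1..2 * CARD('n)}"
  show lin: "linear V"
    by (rule linearI)
       (simp_all add: V_def inner_add_left scaleR_add_left sum.distrib scaleR_sum_right)
  show VE: "V (E i) = F i" if "i \<in> ?S" for i
  proof -
    have "V (E i) = (\<Sum>k\<in>?S. if k = i then F i else 0)"
      unfolding V_def
      by (intro sum.cong refl) (use that in \<open>auto simp: unitary_frame_inner[OF E]\<close>)
    also have "\<dots> = F i" using that by simp
    finally show ?thesis .
  qed
  have VF: "V u \<bullet> F k = u \<bullet> E k" if "k \<in> ?S" for u k
  proof -
    have "V u \<bullet> F k = (\<Sum>i\<in>?S. if i = k then u \<bullet> E k else 0)"
      unfolding V_def inner_sum_left
      by (intro sum.cong refl) (use that in \<open>auto simp: unitary_frame_inner[OF F]\<close>)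
    also have "\<dots> = u \<bullet> E k" using that by simp
    finally show ?thesis .
  qed
  have "V u \<bullet> V v = (\<Sum>i\<in>?S. (v \<bullet> E i) * (V u \<bullet> F i))"
    by (subst (2) V_def) (simp add: inner_sum_right)
  also have "\<dots> = (\<Sum>i\<in>?S. (v \<bullet> E i) * (u \<bullet> E i))"
    by (intro sum.cong refl) (simp add: VF)
  also have "\<dots> = u \<bullet> (\<Sum>i\<in>?S. (v \<bullet> E i) *\<^sub>R E i)"
    by (simp add: inner_sum_right)
  finally show "V u \<bullet> V v = u \<bullet> v" unfolding unitary_frame_expansion[OF E] .
  interpret rot: bounded_linear rot by (rule bounded_linear_rot)
  have rot_basis: "V (rot (E i)) = rot (F i)" if "i \<in> ?S" for i
    unfolding unitary_frame_rot[OF E that] unitary_frame_rot[OF F that] linear_scale[OF lin]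
    using VE[OF partner_in[OF that]] by simp
  have "V (rot u) = V (rot (\<Sum>i\<in>?S. (u \<bullet> E i) *\<^sub>R E i))"
    unfolding unitary_frame_expansion[OF E] ..
  also have "\<dots> = (\<Sum>i\<in>?S. (u \<bullet> E i) *\<^sub>R V (rot (E i)))"
    by (simp add: rot.sum rot.scaleR linear_sum[OF lin] linear_scale[OF lin])
  also have "\<dots> = (\<Sum>i\<in>?S. (u \<bullet> E i) *\<^sub>R rot (F i))"
    using rot_basis by (intro sum.cong refl) simp
  also have "\<dots> = rot (V u)" by (simp add: V_def rot.sum rot.scaleR)
  finally show "V (rot u) = rot (V u)" .
qed

lemma oriented_frame_lift_at:
  fixes E :: "nat \<Rightarrow> 'n::finite plane"
  assumes "unitary_frame E"
  shows "oriented_frame p (\<lambda>i. lift_at p (E i))"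
proof -
  have "span ((\<lambda>i. lift_at p (E i)) ` {1..2 * CARD('n)}) = lift_at p ` span (E ` {1..2 * CARD('n)})"
    unfolding linear_span_image[OF linear_lift_at, symmetric] by (simp add: image_image)
  then show ?thesis
    unfolding oriented_frame_def span_unitary_frame[OF assms] contact_space_eq
    using assms by (simp add: levi_eq J_eq unitary_frame_def)
qed

lemma oriented_frame_proj:
  fixes e :: "nat \<Rightarrow> 'n::finite heis"
  assumes "oriented_frame p e"
  shows "unitary_frame (\<lambda>i. proj (e i))"
    and "i \<in> {1..2 * CARD('n)} \<Longrightarrow> contact_form p (e i) = 0"
proof -
  show horizontal: "contact_form p (e i) = 0" if "i \<in> {1..2 * CARD('n)}" for i
    unfolding mem_contact_space_iff[symmetric]
    using assms that unfolding oriented_frame_def by (metis imageI span_base)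
  show "unitary_frame (\<lambda>i. proj (e i))"
    using assms horizontal unfolding unitary_frame_def oriented_frame_def
    by (simp add: levi_eq J_eq)
qed

lemma wedge_levi_lift_at:
  assumes "\<And>i. i \<in> {1..j} \<Longrightarrow> v i = lift_at p (Z i)"
  shows "wedge (levi p) j v w = wedge (\<bullet>) j Z (\<lambda>i. proj (w i))"
  by (rule wedge_cong) (simp add: assms levi_eq)

lemma proj_has_vector_derivative:
  "(f has_vector_derivative f') F \<Longrightarrow> ((\<lambda>s. proj (f s)) has_vector_derivative proj f') F"
  by (rule bounded_linear.has_vector_derivative[OF bounded_linear_proj])

section \<open>Existence\<close>

text \<open>
  The derivative of \<open>\<langle>Z\<^sub>k, E\<^sub>i\<rangle> = 0\<close>, for \<open>i > k\<close>, expresses \<open>\<langle>Z\<^sub>k\<^sub>+\<^sub>1, E\<^sub>i\<rangle>\<close> by row \<open>i\<close> of the matrix and the products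
  \<open>\<langle>Z\<^sub>k, E\<^sub>j\<rangle>\<close> with \<open>j \<le> k\<close>.  As \<open>k < n\<close>, that part of row \<open>i\<close> is zero except for the entry \<open>- \<kappa>\<^sub>k\<close> when
  \<open>i = k + 1\<close>.  Working with inner products avoids differentiating the coefficients of \<open>Z\<^sub>k\<close>.
\<close>

lemma frenet_derivatives_triangular:
  fixes Z E :: "nat \<Rightarrow> real \<Rightarrow> 'a::real_inner"
  assumes I: "open I"
    and E: "\<And>i s. i \<in> {1..2*n} \<Longrightarrow> s \<in> I \<Longrightarrow>
      (E i has_vector_derivative (\<Sum>j\<in>{1..2*n}. frenet n \<kappa> i j s *\<^sub>R E j s)) (at s)"
    and orth: "\<And>i j s. i \<in> {1..2*n} \<Longrightarrow> j \<in> {1..2*n} \<Longrightarrow> s \<in> I \<Longrightarrow> E i s \<bullet> E j s = (if i = j then 1 else 0)"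
    and Z1: "\<And>s. s \<in> I \<Longrightarrow> Z 1 s = E 1 s"
    and Z: "\<And>k s. s \<in> I \<Longrightarrow> (Z k has_vector_derivative Z (Suc k) s) (at s)"
  shows "k \<in> {1..n} \<Longrightarrow> (\<forall>s\<in>I. (\<forall>i\<in>{k<..2*n}. Z k s \<bullet> E i s = 0) \<and> Z k s \<bullet> E k s = (\<Prod>l\<in>{1..<k}. \<kappa> l s))"
proof (induction k)
  case (Suc k)
  show ?case
  proof (cases "k = 0")
    case True
    then show ?thesis using Suc.prems orth Z1 by auto
  next
    case False
    with Suc.prems have k: "k \<in> {1..<n}" by auto
    with Suc have IH: "\<And>s i. s \<in> I \<Longrightarrow> i \<in> {k<..2*n} \<Longrightarrow> Z k s \<bullet> E i s = 0"
      "\<And>s. s \<in> I \<Longrightarrow> Z k s \<bullet> E k s = (\<Prod>l\<in>{1..<k}. \<kappa> l s)" by auto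
    have step: "Z (Suc k) s \<bullet> E i s = - (\<Sum>j\<in>{1..2*n}. frenet n \<kappa> i j s * (Z k s \<bullet> E j s))"
      if "s \<in> I" "i \<in> {k<..2*n}" for s i
    proof -
      have "i \<in> {1..2*n}" using that by auto
      from inner_constant_derivative[OF I that(1) IH(1)[OF _ that(2)] Z[OF that(1)] E[OF this that(1)]]
      show ?thesis by (simp add: inner_sum_right)
    qed
    have "Z (Suc k) s \<bullet> E i s = 0" if "s \<in> I" "i \<in> {Suc k<..2*n}" for s i
    proof -
      have "frenet n \<kappa> i j s * (Z k s \<bullet> E j s) = 0" if "j \<in> {1..2*n}" for j
      proof (cases "j \<le> k")
        case True
        then show ?thesis using k \<open>i \<in> _\<close> by (auto simp: frenet_def chain_def)
      next
        case False
        then show ?thesis using IH(1)[of s j] that \<open>s \<in> I\<close> by simp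
      qed
      then have "(\<Sum>j\<in>{1..2*n}. frenet n \<kappa> i j s * (Z k s \<bullet> E j s)) = 0" by (intro sum.neutral) blast
      then show ?thesis using step[of s i] that by simp
    qed
    moreover have "Z (Suc k) s \<bullet> E (Suc k) s = (\<Prod>l\<in>{1..<Suc k}. \<kappa> l s)" if "s \<in> I" for s
    proof -
      have "frenet n \<kappa> (Suc k) j s * (Z k s \<bullet> E j s) = (if j = k then - \<kappa> k s * (Z k s \<bullet> E k s) else 0)"
        if "j \<in> {1..2*n}" for j
      proof (cases "j \<le> k")
        case True
        then show ?thesis using k by (auto simp: frenet_def chain_def)
      next
        case False
        then show ?thesis using IH(1)[of s j] that \<open>s \<in> I\<close> by simp
      qed
      then have "(\<Sum>j\<in>{1..2*n}. frenet n \<kappa> (Suc k) j s * (Z k s \<bullet> E j s))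
          = (\<Sum>j\<in>{1..2*n}. if j = k then - \<kappa> k s * (Z k s \<bullet> E k s) else 0)"
        by (intro sum.cong refl) blast
      also have "\<dots> = - \<kappa> k s * (Z k s \<bullet> E k s)" using k by simp
      finally show ?thesis
        using step[OF that, of "Suc k"] k IH(2)[OF that] by (simp add: atLeastLessThanSuc mult.commute)
    qed
    ultimately show ?thesis by blast
  qed
qed simp

lemma standard_unitary_frame: "\<exists>c :: nat \<Rightarrow> 'n::finite plane. unitary_frame c"
proof -
  obtain h where h: "bij_betw h {1..CARD('n)} (UNIV :: 'n set)"
    using ex_bij_betw_nat_finite_1[OF finite_class.finite_UNIV] by blast
  define c :: "nat \<Rightarrow> 'n plane" where
    "c i = (if i \<le> CARD('n) then (axis (h i) 1, 0) else (0, axis (h (i - CARD('n))) 1))" for i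
  have h_eq: "h i = h k \<longleftrightarrow> i = k" if "i \<in> {1..CARD('n)}" "k \<in> {1..CARD('n)}" for i k
    using inj_on_eq_iff[OF bij_betw_imp_inj_on[OF h] that] .
  have "c i \<bullet> c k = (if i = k then 1 else 0)" if ik: "i \<in> {1..2 * CARD('n)}" "k \<in> {1..2 * CARD('n)}" for i k
  proof (cases "(i \<le> CARD('n)) = (k \<le> CARD('n))")
    case True
    show ?thesis
    proof (cases "i \<le> CARD('n)")
      case le: True
      then show ?thesis using True ik h_eq[of i k] by (simp add: c_def inner_prod_def inner_axis_axis)
    next
      case gt: False
      then have "h (i - CARD('n)) = h (k - CARD('n)) \<longleftrightarrow> i = k"
      proof -
        have "i - CARD('n) \<in> {1..CARD('n)}" "k - CARD('n) \<in> {1..CARD('n)}"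
          using True gt ik by auto
        from h_eq[OF this] show ?thesis using True gt by auto
      qed
      then show ?thesis using True gt by (simp add: c_def inner_prod_def inner_axis_axis)
    qed
  next
    case False
    then show ?thesis by (auto simp add: c_def inner_prod_def)
  qed
  moreover have "c (CARD('n) + j) = rot (c j)" if "j \<in> {1..CARD('n)}" for j
    using that by (simp add: c_def rot_def)
  ultimately show ?thesis unfolding unitary_frame_def by blast
qed

text \<open>
  Skewness keeps the solution orthonormal.  The relation \<open>E\<^sub>n\<^sub>+\<^sub>j = rot E\<^sub>j\<close> is kept because the family
  obtained by applying \<open>rot\<close> and relabelling with signs solves the same system with the same initial value.
\<close>

lemma frenet_frame_exists:
  assumes I: "open I" "is_interval I" "I \<noteq> {}"
    and \<kappa>: "\<And>j. j \<in> {1..CARD('n::finite)} \<Longrightarrow> smooth_on I (\<kappa> j)"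
  obtains E :: "nat \<Rightarrow> real \<Rightarrow> 'n::finite plane"
  where "\<And>s. s \<in> I \<Longrightarrow> unitary_frame (\<lambda>i. E i s)"
    and "\<And>i s. i \<in> {1..2 * CARD('n)} \<Longrightarrow> s \<in> I \<Longrightarrow>
      (E i has_vector_derivative (\<Sum>j\<in>{1..2 * CARD('n)}. frenet CARD('n) \<kappa> i j s *\<^sub>R E j s)) (at s)"
proof -
  let ?n = "CARD('n)" and ?S = "{1..2 * CARD('n)}"
  obtain t0 where t0: "t0 \<in> I" using I(3) by blast
  obtain c :: "nat \<Rightarrow> 'n plane" where c: "unitary_frame c" using standard_unitary_frame by blast
  have "continuous_on I (frenet ?n \<kappa> i j)" if "i \<in> ?S" "j \<in> ?S" for i j
    by (rule smooth_on_imp_continuous_on[OF smooth_on_frenet[OF I(1) \<kappa> that]])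
  then obtain E where E0: "\<And>i. i \<in> ?S \<Longrightarrow> E i t0 = c i"
    and E: "\<And>i s. i \<in> ?S \<Longrightarrow> s \<in> I \<Longrightarrow> (E i has_vector_derivative (\<Sum>j\<in>?S. frenet ?n \<kappa> i j s *\<^sub>R E j s)) (at s)"
    by (rule linear_system_has_solution[OF I(1,2) t0 finite_atLeastAtMost, of 1 "2 * ?n" "frenet ?n \<kappa>" c])
       blast+
  have orth: "E i s \<bullet> E j s = (if i = j then 1 else 0)" if "i \<in> ?S" "j \<in> ?S" "s \<in> I" for i j s
    by (rule skew_system_orthonormal[OF I(2) t0 finite_atLeastAtMost frenet_skew E _ that])
       (simp_all only: E0 unitary_frame_inner[OF c])
  \<comment> \<open>The inverse \<open>- rot\<close> of \<open>rot\<close> is applied to the relabelled frame, so that \<open>w = E\<close> says exactly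
    that the frame is compatible with \<open>rot\<close>.\<close>
  define w where "w i s = (- partner_sign ?n i) *\<^sub>R rot (E (partner ?n i) s)" for i s
  interpret rot: bounded_linear rot by (rule bounded_linear_rot)
  have w: "(w i has_vector_derivative (\<Sum>k\<in>?S. frenet ?n \<kappa> i k s *\<^sub>R w k s)) (at s)"
    if i: "i \<in> ?S" and s: "s \<in> I" for i s
  proof -
    have "(w i has_vector_derivative
        (- partner_sign ?n i) *\<^sub>R rot (\<Sum>j\<in>?S. frenet ?n \<kappa> (partner ?n i) j s *\<^sub>R E j s)) (at s)"
      unfolding w_def[abs_def]
      by (rule bounded_linear.has_vector_derivative[OF bounded_linear_scaleR_right],
          rule rot.has_vector_derivative, rule E[OF partner_in[OF i] s])
    also have "(- partner_sign ?n i) *\<^sub>R rot (\<Sum>j\<in>?S. frenet ?n \<kappa> (partner ?n i) j s *\<^sub>R E j s)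
        = (\<Sum>j\<in>?S. (- partner_sign ?n i * frenet ?n \<kappa> (partner ?n i) j s) *\<^sub>R rot (E j s))"
      by (simp add: rot.sum rot.scaleR scaleR_sum_right sum_negf)
    also have "\<dots> = (\<Sum>k\<in>?S. frenet ?n \<kappa> i k s *\<^sub>R w k s)"
    proof (rule sum.reindex_bij_witness[of _ "partner ?n" "partner ?n"])
      fix j assume j: "j \<in> ?S"
      let ?k = "partner ?n j"
      have k: "?k \<in> ?S" using partner_in[OF j] .
      have "frenet ?n \<kappa> i ?k s * partner_sign ?n ?k
          = partner_sign ?n i * frenet ?n \<kappa> (partner ?n i) j s * (partner_sign ?n ?k * partner_sign ?n ?k)"
        unfolding frenet_partner[OF i k, symmetric] partner_partner[OF j] by (simp only: mult_ac)
      then have "frenet ?n \<kappa> i ?k s * (- partner_sign ?n ?k) = - partner_sign ?n i * frenet ?n \<kappa> (partner ?n i) j s"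
        by simp
      then show "frenet ?n \<kappa> i ?k s *\<^sub>R w ?k s
          = (- partner_sign ?n i * frenet ?n \<kappa> (partner ?n i) j s) *\<^sub>R rot (E j s)"
        unfolding w_def partner_partner[OF j] by (simp only: scaleR_scaleR)
    qed (use partner_in partner_partner in blast)+
    finally show ?thesis .
  qed
  have w0: "w i t0 = E i t0" if i: "i \<in> ?S" for i
  proof -
    have "rot (c (partner ?n i)) = partner_sign ?n (partner ?n i) *\<^sub>R c i"
      using unitary_frame_rot[OF c partner_in[OF i]] partner_partner[OF i] by simp
    then show ?thesis
      unfolding w_def E0[OF i] E0[OF partner_in[OF i]] partner_sign_partner[OF i] by simp
  qed
  have "unitary_frame (\<lambda>i. E i s)" if s: "s \<in> I" for s
    unfolding unitary_frame_def
  proof (intro conjI ballI)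
    show "E i s \<bullet> E k s = (if i = k then 1 else 0)" if "i \<in> ?S" "k \<in> ?S" for i k
      using orth[OF that s] .
    fix j assume j: "j \<in> {1..?n}"
    then have "?n + j \<in> ?S" by auto
    from skew_system_unique[OF I(2) t0 finite_atLeastAtMost frenet_skew w E w0 this s]
    show "E (?n + j) s = rot (E j s)"
      using j unfolding w_def partner_sign_def partner_def by simp
  qed
  then show ?thesis using that E by blast
qed

text \<open>
  The derivatives \<open>Z\<^sub>k\<close> are triangular in the frame with nonzero diagonal, so their wedge products are
  nonzero multiples of those of the frame.  The span of \<open>Z\<^sub>1, \<dots>, Z\<^sub>n\<close> is totally real because it is orthogonal to
  \<open>rot E\<^sub>1, \<dots>, rot E\<^sub>n\<close>: if \<open>X\<close> and \<open>rot X\<close> are both orthogonal to these, \<open>X\<close> is orthogonal to the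
  whole frame.
\<close>

lemma frenet_curve_has_invariants:
  fixes \<gamma> :: "real \<Rightarrow> 'n::finite heis" and E :: "nat \<Rightarrow> real \<Rightarrow> 'n plane"
  assumes I: "open I" and \<gamma>: "smooth_on I \<gamma>"
    and E_smooth: "\<And>i. i \<in> {1..2 * CARD('n)} \<Longrightarrow> smooth_on I (E i)"
    and frame: "\<And>s. s \<in> I \<Longrightarrow> unitary_frame (\<lambda>i. E i s)"
    and E: "\<And>i s. i \<in> {1..2 * CARD('n)} \<Longrightarrow> s \<in> I \<Longrightarrow>
      (E i has_vector_derivative (\<Sum>j\<in>{1..2 * CARD('n)}. frenet CARD('n) \<kappa> i j s *\<^sub>R E j s)) (at s)"
    and \<kappa>: "\<And>j s. j \<in> {1..<CARD('n)} \<Longrightarrow> s \<in> I \<Longrightarrow> \<kappa> j s \<noteq> 0"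
    and velocity: "\<And>s. s \<in> I \<Longrightarrow> proj (vector_derivative \<gamma> (at s)) = E 1 s"
    and contact: "\<And>s. s \<in> I \<Longrightarrow> contact_form (\<gamma> s) (vector_derivative \<gamma> (at s)) = \<tau> s"
  shows "curve_with_invariants I \<kappa> \<tau> \<gamma>"
proof -
  let ?n = "CARD('n)" and ?S = "{1..2 * CARD('n)}"
  have n: "?n \<in> {1..?n}" "1 \<in> ?S" by (auto simp: Suc_le_eq)
  define Z where "Z k s = proj (nth_vector_derivative k \<gamma> s)" for k s
  define e where "e i s = lift_at (\<gamma> s) (E i s)" for i s
  let ?h = "\<lambda>s k. horizontal_deriv \<gamma> k s"
  have h: "?h s k = lift_at (\<gamma> s) (Z k s)" for k s
    by (simp add: horizontal_deriv_def horizontal_part_eq Z_def)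
  have Z: "(Z k has_vector_derivative Z (Suc k) s) (at s)" if "s \<in> I" for k s
    unfolding Z_def[abs_def]
    by (rule proj_has_vector_derivative[OF has_vector_derivative_nth_vector_derivative[OF I \<gamma> that]])
  have Z1: "Z 1 s = E 1 s" if "s \<in> I" for s
    using velocity[OF that] by (simp add: Z_def nth_vector_derivative_Suc)
  note inner = unitary_frame_inner[OF frame]
  have tri: "Z k s \<bullet> E i s = 0" if "k \<in> {1..?n}" "s \<in> I" "i \<in> {k<..2 * ?n}" for k s i
    using frenet_derivatives_triangular[OF I E inner Z1 Z that(1)] that by blast
  have diag: "Z k s \<bullet> E k s \<noteq> 0" if "k \<in> {1..?n}" "s \<in> I" for k s
  proof -
    have "Z k s \<bullet> E k s = (\<Prod>l\<in>{1..<k}. \<kappa> l s)"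
      using frenet_derivatives_triangular[OF I E inner Z1 Z that(1)] that by blast
    also have "\<dots> \<noteq> 0" using \<kappa> that by auto
    finally show ?thesis .
  qed
  have expand: "levi (\<gamma> s) (?h s a) y = (\<Sum>b\<in>{1..a}. (Z a s \<bullet> E b s) * levi (\<gamma> s) (e b s) y)"
    if "a \<in> {1..?n}" "s \<in> I" for a s y
  proof -
    have "levi (\<gamma> s) (?h s a) y = (\<Sum>b\<in>?S. (Z a s \<bullet> E b s) *\<^sub>R E b s) \<bullet> proj y"
      unfolding unitary_frame_expansion[OF frame[OF that(2)]] by (simp add: levi_eq h)
    also have "\<dots> = (\<Sum>b\<in>?S. (Z a s \<bullet> E b s) * (E b s \<bullet> proj y))"
      by (simp add: inner_sum_left)
    also have "\<dots> = (\<Sum>b\<in>{1..a}. (Z a s \<bullet> E b s) * (E b s \<bullet> proj y))"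
      using that tri by (intro sum.mono_neutral_right) auto
    finally show ?thesis by (simp add: levi_eq e_def)
  qed
  \<comment> \<open>The factor relating the two wedge products; its sign is the sign \<open>\<epsilon>\<close> of an adapted frame.\<close>
  define P where "P j s = (\<Prod>a\<in>{1..j}. Z a s \<bullet> E a s)" for j s
  have P: "P j s \<noteq> 0" if "j \<in> {1..?n}" "s \<in> I" for j s
    using diag that by (auto simp: P_def)
  have wedge_h: "wedge (levi (\<gamma> s)) j (?h s) w = P j s * wedge (levi (\<gamma> s)) j (\<lambda>i. e i s) w"
    if "j \<in> {1..?n}" "s \<in> I" for j s w
    unfolding P_def
  proof (rule wedge_triangular_combination[where z = "?h s" and e = "\<lambda>i. e i s"
        and c = "\<lambda>a b. Z a s \<bullet> E b s"])
    fix a y assume "a \<in> {1..j}"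
    then show "levi (\<gamma> s) (?h s a) y = (\<Sum>b\<in>{1..a}. (Z a s \<bullet> E b s) * levi (\<gamma> s) (e b s) y)"
      using that by (intro expand) auto
  qed
  have levi_e: "levi (\<gamma> s) (e i s) (e k s) = (if i = k then 1 else 0)" if "i \<in> ?S" "k \<in> ?S" "s \<in> I" for i k s
    using inner[OF that(3,1,2)] by (simp add: levi_eq e_def)
  have wedge_hh: "wedge (levi (\<gamma> s)) j (?h s) (?h s) = P j s * P j s" if "j \<in> {1..?n}" "s \<in> I" for j s
  proof -
    have sym: "levi (\<gamma> s) x y = levi (\<gamma> s) y x" for x y by (simp add: levi_eq inner_commute)
    have "wedge (levi (\<gamma> s)) j (\<lambda>i. e i s) (?h s) = wedge (levi (\<gamma> s)) j (?h s) (\<lambda>i. e i s)"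
      by (rule wedge_sym[OF sym])
    also have "\<dots> = P j s * wedge (levi (\<gamma> s)) j (\<lambda>i. e i s) (\<lambda>i. e i s)"
      by (rule wedge_h[OF that])
    also have "wedge (levi (\<gamma> s)) j (\<lambda>i. e i s) (\<lambda>i. e i s) = (\<Prod>a\<in>{1..j}. levi (\<gamma> s) (e a s) (e a s))"
      by (rule wedge_lower_triangular) (use that levi_e in auto)
    also have "\<dots> = 1" by (rule prod.neutral) (use that levi_e in auto)
    finally show ?thesis using wedge_h[OF that] by simp
  qed
  have regular: "horizontally_regular I \<gamma>"
    unfolding horizontally_regular_def
  proof (intro conjI ballI \<gamma> notI)
    fix s assume s: "s \<in> I" and "?h s 1 = 0"
    then have "proj (?h s 1) = 0" by simp
    then have "E 1 s = 0" unfolding h proj_lift_at Z1[OF s] .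
    then show False using inner[OF s n(2,2)] by simp
  qed
  have real: "totally_real (\<gamma> s) (span (?h s ` {1..?n}))" if s: "s \<in> I" for s
  proof -
    \<comment> \<open>The horizontal vectors orthogonal to \<open>rot E\<^sub>1, \<dots>, rot E\<^sub>n\<close>.\<close>
    define Q where "Q = {X. contact_form (\<gamma> s) X = 0 \<and> (\<forall>i\<in>{?n<..2 * ?n}. proj X \<bullet> E i s = 0)}"
    interpret proj: bounded_linear proj by (rule bounded_linear_proj)
    have "subspace Q"
      unfolding Q_def subspace_def
      by (simp add: contact_form_0 contact_form_add contact_form_scaleR proj.add proj.scaleR inner_add_left)
    moreover have "?h s ` {1..?n} \<subseteq> Q"
      using tri[OF _ s] by (auto simp: Q_def h)
    ultimately have span_Q: "span (?h s ` {1..?n}) \<subseteq> Q" by (rule span_minimal[rotated])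
    have zero: "X = 0" if "X \<in> Q" "J (\<gamma> s) X \<in> Q" for X
    proof -
      have "proj X = 0"
      proof (rule unitary_frame_eq_0[OF frame[OF s]])
        fix i assume i: "i \<in> ?S"
        show "proj X \<bullet> E i s = 0"
        proof (cases "i \<le> ?n")
          case True
          with i have "E (?n + i) s = rot (E i s)" and "?n + i \<in> {?n<..2 * ?n}"
            using frame[OF s] unfolding unitary_frame_def by auto
          moreover from this(2) that(2) have "rot (proj X) \<bullet> E (?n + i) s = 0"
            unfolding Q_def J_eq by auto
          ultimately show ?thesis by simp
        qed (use that(1) i in \<open>auto simp: Q_def\<close>)
      qed
      then show "X = 0"
        using that(1) by (intro tangent_vector_eqI[of X 0 "\<gamma> s"]) (auto simp: Q_def contact_form_eq)
    qed
    have "Q \<subseteq> contact_space (\<gamma> s)"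
      unfolding Q_def using mem_contact_space_iff by blast
    then show ?thesis
      using span_Q zero subspace_span unfolding totally_real_def by blast
  qed
  have "nondegenerate I \<gamma>"
    unfolding nondegenerate_def
  proof (intro conjI ballI regular real)
    fix s assume s: "s \<in> I"
    show "wedge (levi (\<gamma> s)) ?n (?h s) \<noteq> (\<lambda>_. 0)"
    proof
      assume "wedge (levi (\<gamma> s)) ?n (?h s) = (\<lambda>_. 0)"
      from fun_cong[OF this, of "?h s"] show False using wedge_hh[OF n(1) s] P[OF n(1) s] by simp
    qed
  qed
  moreover have "horizontal_arclength I \<gamma>"
    unfolding horizontal_arclength_def
  proof
    fix s assume s: "s \<in> I"
    show "sqrt (levi (\<gamma> s) (?h s 1) (?h s 1)) = 1"
      unfolding h levi_eq proj_lift_at contact_form_lift_at Z1[OF s] inner[OF s n(2,2)] by simp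
  qed
  moreover have "has_contact_normality I \<gamma> \<tau>"
    unfolding has_contact_normality_iff using contact by blast
  moreover have "has_p_curvatures I \<gamma> \<kappa>"
    unfolding has_p_curvatures_def
  proof (intro exI[of _ e] conjI ballI)
    have e_smooth: "smooth_on I (e i)" if "i \<in> ?S" for i
    proof -
      have "Ck_on k I (e i)" for k
      proof -
        note 1 = Ck_on_bounded_linear[OF _ I, where k = k]
        have E_k: "Ck_on k I (E i)" and \<gamma>_k: "Ck_on k I \<gamma>"
          using E_smooth[OF that] \<gamma> unfolding smooth_on_def by auto
        show ?thesis
          unfolding e_def[abs_def] lift_at_def
          by (intro Ck_on_Pair[OF I] 1[OF bounded_linear_fst E_k] 1[OF bounded_linear_snd E_k]
               1[OF bounded_linear_minus[OF bounded_linear_ident]]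
               Ck_on_bounded_bilinear[OF bounded_bilinear_inner I _ E_k]
               1[OF bounded_linear_rot] 1[OF bounded_linear_proj \<gamma>_k])
      qed
      then show ?thesis by (simp add: smooth_on_def)
    qed
    show "adapted_frame I \<gamma> e"
      unfolding adapted_frame_def
    proof (intro conjI ballI e_smooth)
      show "oriented_frame (\<gamma> s) (\<lambda>i. e i s)" if "s \<in> I" for s
        unfolding e_def by (rule oriented_frame_lift_at[OF frame[OF that]])
      fix s j assume s: "s \<in> I" and j: "j \<in> {1..?n}"
      have norm: "wedge_norm (levi (\<gamma> s)) j (?h s) = \<bar>P j s\<bar>"
        unfolding wedge_norm_def wedge_hh[OF j s] by simp
      have "wedge (levi (\<gamma> s)) j (\<lambda>i. e i s) w
          = sgn (P j s) * (wedge (levi (\<gamma> s)) j (?h s) w / wedge_norm (levi (\<gamma> s)) j (?h s))" for w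
        unfolding norm wedge_h[OF j s] using P[OF j s] by (simp add: sgn_if)
      moreover have "sgn (P j s) \<in> {1, -1}" using P[OF j s] by (simp add: sgn_if)
      ultimately show "\<exists>\<epsilon>\<in>{1, -1}. \<forall>w. wedge (levi (\<gamma> s)) j (\<lambda>i. e i s) w
          = \<epsilon> * (wedge (levi (\<gamma> s)) j (?h s) w / wedge_norm (levi (\<gamma> s)) j (?h s))"
        by blast
    qed
    fix j s assume j: "j \<in> {1..?n}" and s: "s \<in> I"
    then have jS: "j \<in> ?S" by auto
    define m where "m = (if j < ?n then j + 1 else 2 * ?n)"
    have m: "m \<in> ?S" using j by (auto simp: m_def)
    have "((\<lambda>s. proj (e j s)) has_vector_derivative proj (vector_derivative (e j) (at s))) (at s)"
      by (rule proj_has_vector_derivative[OF smooth_on_curve_derivative(1)[OF I e_smooth[OF jS] s]])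
    then have "(E j has_vector_derivative proj (vector_derivative (e j) (at s))) (at s)"
      by (simp add: e_def)
    then have D: "proj (vector_derivative (e j) (at s)) = (\<Sum>k\<in>?S. frenet ?n \<kappa> j k s *\<^sub>R E k s)"
      using vector_derivative_unique_at E[OF jS s] by blast
    have "p_curvature \<gamma> e j s = proj (vector_derivative (e j) (at s)) \<bullet> E m s"
      by (simp add: p_curvature_def m_def levi_eq e_def)
    also have "\<dots> = (\<Sum>k\<in>?S. if k = m then frenet ?n \<kappa> j m s else 0)"
      unfolding D inner_sum_left
      by (intro sum.cong refl) (use m inner[OF s] in auto)
    also have "\<dots> = frenet ?n \<kappa> j m s" using m by simp
    also have "\<dots> = \<kappa> j s"
      using j by (auto simp: m_def frenet_def chain_def)
    finally show "p_curvature \<gamma> e j s = \<kappa> j s" .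
  qed
  ultimately show ?thesis unfolding curve_with_invariants_def by blast
qed

theorem curve_with_invariants_exists:
  assumes I: "open I" "is_interval I" "I \<noteq> {}"
    and \<kappa>: "\<And>j. j \<in> {1..CARD('n::finite)} \<Longrightarrow> smooth_on I (\<kappa> j)"
    and \<tau>: "smooth_on I \<tau>"
    and \<kappa>_nonzero: "\<And>j s. j \<in> {1..<CARD('n)} \<Longrightarrow> s \<in> I \<Longrightarrow> \<kappa> j s \<noteq> 0"
  shows "\<exists>\<gamma> :: real \<Rightarrow> 'n::finite heis. curve_with_invariants I \<kappa> \<tau> \<gamma>"
proof -
  let ?n = "CARD('n)" and ?S = "{1..2 * CARD('n)}"
  have one: "1 \<in> ?S" by (auto simp: Suc_le_eq)
  obtain t0 where t0: "t0 \<in> I" using I(3) by blast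
  obtain E :: "nat \<Rightarrow> real \<Rightarrow> 'n plane"
    where frame: "\<And>s. s \<in> I \<Longrightarrow> unitary_frame (\<lambda>i. E i s)"
      and E: "\<And>i s. i \<in> ?S \<Longrightarrow> s \<in> I \<Longrightarrow>
        (E i has_vector_derivative (\<Sum>j\<in>?S. frenet ?n \<kappa> i j s *\<^sub>R E j s)) (at s)"
    using frenet_frame_exists[where 'n = 'n and \<kappa> = \<kappa>, OF I \<kappa>] by blast
  have E_smooth: "smooth_on I (E i)" if "i \<in> ?S" for i
    using smooth_on_linear_system[OF I(1) smooth_on_frenet[OF I(1) \<kappa>] E that] .
  have Ck: "Ck_on k I (E 1)" "Ck_on k I \<tau>" for k
    using E_smooth[OF one] \<tau> unfolding smooth_on_def by auto
  note continuous = Ck[of 0, unfolded Ck_on.simps]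
  obtain z where z: "\<And>s. s \<in> I \<Longrightarrow> (z has_vector_derivative E 1 s) (at s)"
    using antiderivative_open_interval[OF I(1,2) t0 continuous(1)] by blast
  have z_k: "Ck_on k I z" for k
    using Ck_on_decrease[OF Ck_on_curve_Suc[OF I(1) z Ck(1)]] .
  define f where "f s = \<tau> s + (- (rot (z s) \<bullet> E 1 s))" for s
  note linear = Ck_on_bounded_linear[OF _ I(1)]
  have f_k: "Ck_on k I f" for k
    unfolding f_def[abs_def]
    by (intro Ck_on_add[OF I(1) Ck(2)] linear[OF bounded_linear_minus[OF bounded_linear_ident]]
         Ck_on_bounded_bilinear[OF bounded_bilinear_inner I(1) linear[OF bounded_linear_rot z_k] Ck(1)])
  obtain t where t: "\<And>s. s \<in> I \<Longrightarrow> (t has_vector_derivative f s) (at s)"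
    using antiderivative_open_interval[OF I(1,2) t0 f_k[of 0, unfolded Ck_on.simps]] by blast
  have t_k: "Ck_on k I t" for k
    using Ck_on_decrease[OF Ck_on_curve_Suc[OF I(1) t f_k]] .
  define \<gamma> where "\<gamma> s = (fst (z s), snd (z s), t s)" for s
  have proj_\<gamma>: "proj (\<gamma> s) = z s" for s by (simp add: \<gamma>_def proj_def)
  have "Ck_on k I \<gamma>" for k
    unfolding \<gamma>_def[abs_def]
    by (intro Ck_on_Pair[OF I(1)] linear[OF bounded_linear_fst z_k] linear[OF bounded_linear_snd z_k] t_k)
  then have \<gamma>: "smooth_on I \<gamma>" by (simp add: smooth_on_def)
  have velocity: "vector_derivative \<gamma> (at s) = (fst (E 1 s), snd (E 1 s), f s)" if "s \<in> I" for s
    unfolding \<gamma>_def[abs_def]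
    by (intro vector_derivative_at has_vector_derivative_Pair t[OF that]
         bounded_linear.has_vector_derivative[OF bounded_linear_fst z[OF that]]
         bounded_linear.has_vector_derivative[OF bounded_linear_snd z[OF that]])
  have "curve_with_invariants I \<kappa> \<tau> \<gamma>"
  proof (rule frenet_curve_has_invariants[OF I(1) \<gamma> E_smooth frame E \<kappa>_nonzero])
    fix s assume s: "s \<in> I"
    show pr: "proj (vector_derivative \<gamma> (at s)) = E 1 s"
      by (simp add: velocity[OF s] proj_def)
    show "contact_form (\<gamma> s) (vector_derivative \<gamma> (at s)) = \<tau> s"
      unfolding contact_form_eq pr proj_\<gamma> by (simp add: velocity[OF s] f_def)
  qed
  then show ?thesis by blast
qed

section \<open>Uniqueness\<close>

text \<open>
  Pairing the wedge products with \<open>E\<^sub>1, \<dots>, E\<^sub>m, v\<close>, for \<open>v\<close> orthogonal to \<open>E\<^sub>1, \<dots>, E\<^sub>m\<close>, makes both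
  determinants triangular.  Comparing them gives \<open>\<langle>E\<^sub>m\<^sub>+\<^sub>1, v\<rangle> = D \<langle>Z\<^sub>m\<^sub>+\<^sub>1, v\<rangle>\<close> with a constant \<open>D\<close>,
  which is nonzero because \<open>v = E\<^sub>m\<^sub>+\<^sub>1\<close> is allowed.
\<close>

lemma orthogonal_flag_of_proportional_wedges:
  fixes E Z :: "nat \<Rightarrow> 'a::real_inner"
  assumes orth: "\<And>i k. i \<in> {1..n} \<Longrightarrow> k \<in> {1..n} \<Longrightarrow> E i \<bullet> E k = (if i = k then 1 else 0)"
    and proportional: "\<And>j. j \<in> {1..n} \<Longrightarrow> \<exists>c. \<forall>w. wedge (\<bullet>) j E w = c * wedge (\<bullet>) j Z w"
  shows "j \<le> n \<Longrightarrow> (\<forall>i\<in>{1..j}. E i \<bullet> v = 0) \<longleftrightarrow> (\<forall>i\<in>{1..j}. Z i \<bullet> v = 0)"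
proof (induction j arbitrary: v rule: less_induct)
  case (less j)
  show ?case
  proof (cases j)
    case (Suc m)
    have m: "m < j" "m \<le> n" "Suc m \<in> {1..n}" using Suc less.prems by auto
    note IH = less.IH[OF m(1,2)]
    obtain c where c: "\<And>w. wedge (\<bullet>) (Suc m) E w = c * wedge (\<bullet>) (Suc m) Z w"
      using proportional[OF m(3)] by blast
    define D where "D = c * (\<Prod>a\<in>{1..m}. Z a \<bullet> E a)"
    have key: "E (Suc m) \<bullet> v = D * (Z (Suc m) \<bullet> v)" if v: "\<forall>i\<in>{1..m}. E i \<bullet> v = 0" for v
    proof -
      define w where "w b = (if b \<le> m then E b else v)" for b
      have interval: "{1..Suc m} = insert (Suc m) {1..m}" by auto
      have "wedge (\<bullet>) (Suc m) E w = (\<Prod>a\<in>{1..Suc m}. E a \<bullet> w a)"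
      proof (rule wedge_lower_triangular)
        fix a b assume ab: "a \<in> {1..Suc m}" "b \<in> {1..Suc m}" "a < b"
        show "E a \<bullet> w b = 0"
        proof (cases "b \<le> m")
          case True
          then show ?thesis using ab m orth[of a b] by (simp add: w_def)
        next
          case False
          then show ?thesis using ab v by (simp add: w_def)
        qed
      qed
      also have "\<dots> = E (Suc m) \<bullet> v * (\<Prod>a\<in>{1..m}. E a \<bullet> w a)"
        unfolding interval by (simp add: w_def)
      also have "(\<Prod>a\<in>{1..m}. E a \<bullet> w a) = 1"
        by (rule prod.neutral) (use m orth in \<open>simp add: w_def\<close>)
      finally have 1: "wedge (\<bullet>) (Suc m) E w = E (Suc m) \<bullet> v" by simp
      have "wedge (\<bullet>) (Suc m) Z w = (\<Prod>a\<in>{1..Suc m}. Z a \<bullet> w a)"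
      proof (rule wedge_lower_triangular)
        fix a b assume ab: "a \<in> {1..Suc m}" "b \<in> {1..Suc m}" "a < b"
        show "Z a \<bullet> w b = 0"
        proof (cases "b \<le> m")
          case True
          have "a < j" "a \<le> n" using ab m Suc by auto
          moreover have "\<forall>i\<in>{1..a}. E i \<bullet> E b = 0"
            using ab m True orth by auto
          ultimately have "\<forall>i\<in>{1..a}. Z i \<bullet> E b = 0" using less.IH by blast
          then show ?thesis using ab True by (simp add: w_def)
        next
          case False
          have "\<forall>i\<in>{1..m}. Z i \<bullet> v = 0" using v IH by blast
          then show ?thesis using False ab by (simp add: w_def)
        qed
      qed
      also have "\<dots> = Z (Suc m) \<bullet> v * (\<Prod>a\<in>{1..m}. Z a \<bullet> w a)"
        unfolding interval by (simp add: w_def)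
      also have "(\<Prod>a\<in>{1..m}. Z a \<bullet> w a) = (\<Prod>a\<in>{1..m}. Z a \<bullet> E a)"
        by (rule prod.cong) (simp_all add: w_def)
      finally show ?thesis using c[of w] 1 by (simp add: D_def mult_ac)
    qed
    have "\<forall>i\<in>{1..m}. E i \<bullet> E (Suc m) = 0" using m orth by auto
    from key[OF this] have "D \<noteq> 0" using orth[OF m(3,3)] by auto
    then have "E (Suc m) \<bullet> v = 0 \<longleftrightarrow> Z (Suc m) \<bullet> v = 0" if "\<forall>i\<in>{1..m}. E i \<bullet> v = 0"
      using key[OF that] by simp
    moreover have "(\<forall>i\<in>{1..j}. f i \<bullet> v = 0) \<longleftrightarrow> (\<forall>i\<in>{1..m}. f i \<bullet> v = 0) \<and> f (Suc m) \<bullet> v = 0"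
      for f :: "nat \<Rightarrow> 'a"
      unfolding Suc by (auto simp: le_Suc_eq)
    ultimately show ?thesis using IH[of v] by blast
  qed simp
qed

text \<open>
  By \<open>orthogonal_flag_of_proportional_wedges\<close>, \<open>Z\<^sub>i\<close> is orthogonal to \<open>E\<^sub>k\<close> for \<open>i < k\<close>.  Differentiating, \<open>E\<^sub>k'\<close> is orthogonal to
  \<open>Z\<^sub>1, \<dots>, Z\<^sub>j\<close>, and hence to \<open>E\<^sub>j\<close>, as soon as \<open>j + 1 < k\<close> and \<open>j < n\<close>.  Here \<open>k\<close> runs up to \<open>2n\<close>, so this
  also annihilates the coefficients that mix \<open>E\<^sub>j\<close> with the vectors \<open>rot E\<^sub>m\<close>.  Skewness and
  compatibility with \<open>rot\<close> give the remaining entries.  Finally the velocity is \<open>\<plusminus> E\<^sub>1\<close>, and the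
  sign is constant by connectedness.
\<close>

lemma curve_with_invariants_frenet_frame:
  fixes \<gamma> :: "real \<Rightarrow> 'n::finite heis"
  assumes I: "open I" "is_interval I" "I \<noteq> {}" and \<gamma>_inv: "curve_with_invariants I \<kappa> \<tau> \<gamma>"
  obtains E :: "nat \<Rightarrow> real \<Rightarrow> 'n plane" and \<epsilon> :: real
  where "\<And>s. s \<in> I \<Longrightarrow> unitary_frame (\<lambda>i. E i s)"
    and "\<And>i s. i \<in> {1..2 * CARD('n)} \<Longrightarrow> s \<in> I \<Longrightarrow>
      (E i has_vector_derivative (\<Sum>j\<in>{1..2 * CARD('n)}. frenet CARD('n) \<kappa> i j s *\<^sub>R E j s)) (at s)"
    and "\<epsilon> * \<epsilon> = 1"
    and "\<And>s. s \<in> I \<Longrightarrow> proj (vector_derivative \<gamma> (at s)) = \<epsilon> *\<^sub>R E 1 s"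
proof -
  let ?n = "CARD('n)" and ?S = "{1..2 * CARD('n)}"
  let ?h = "\<lambda>s k. horizontal_deriv \<gamma> k s"
  have one: "1 \<in> {1..?n}" "1 \<in> ?S" by (auto simp: Suc_le_eq)
  have \<gamma>: "smooth_on I \<gamma>" and arclength: "horizontal_arclength I \<gamma>"
    using \<gamma>_inv unfolding curve_with_invariants_def nondegenerate_def horizontally_regular_def by auto
  obtain e where e: "adapted_frame I \<gamma> e"
    and curvature: "\<And>j s. j \<in> {1..?n} \<Longrightarrow> s \<in> I \<Longrightarrow> p_curvature \<gamma> e j s = \<kappa> j s"
    using \<gamma>_inv unfolding curve_with_invariants_def has_p_curvatures_def by blast
  have e_smooth: "\<And>i. i \<in> ?S \<Longrightarrow> smooth_on I (e i)"
    and e_oriented: "\<And>s. s \<in> I \<Longrightarrow> oriented_frame (\<gamma> s) (\<lambda>i. e i s)"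
    and e_wedge: "\<And>s j. s \<in> I \<Longrightarrow> j \<in> {1..?n} \<Longrightarrow> \<exists>\<epsilon>\<in>{1, -1}. \<forall>w.
        wedge (levi (\<gamma> s)) j (\<lambda>i. e i s) w
        = \<epsilon> * (wedge (levi (\<gamma> s)) j (?h s) w / wedge_norm (levi (\<gamma> s)) j (?h s))"
    using e unfolding adapted_frame_def by blast+
  define E where "E i s = proj (e i s)" for i s
  define Z where "Z k s = proj (nth_vector_derivative k \<gamma> s)" for k s
  have h: "?h s k = lift_at (\<gamma> s) (Z k s)" for k s
    by (simp add: horizontal_deriv_def horizontal_part_eq Z_def)
  have Z: "(Z k has_vector_derivative Z (Suc k) s) (at s)" if "s \<in> I" for k s
    unfolding Z_def[abs_def]
    by (rule proj_has_vector_derivative[OF has_vector_derivative_nth_vector_derivative[OF I(1) \<gamma> that]])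
  have frame: "unitary_frame (\<lambda>i. E i s)" if "s \<in> I" for s
    unfolding E_def by (rule oriented_frame_proj(1)[OF e_oriented[OF that]])
  note inner = unitary_frame_inner[OF frame]
  have e_lift: "e i s = lift_at (\<gamma> s) (E i s)" if "i \<in> ?S" "s \<in> I" for i s
    unfolding E_def using lift_at_proj[OF oriented_frame_proj(2)[OF e_oriented[OF that(2)] that(1)]] by simp
  define D where "D i s = proj (vector_derivative (e i) (at s))" for i s
  have D: "(E i has_vector_derivative D i s) (at s)" if "i \<in> ?S" "s \<in> I" for i s
    unfolding E_def[abs_def] D_def
    by (rule proj_has_vector_derivative[OF smooth_on_curve_derivative(1)[OF I(1) e_smooth[OF that(1)] that(2)]])
  have flag: "(\<forall>i\<in>{1..j}. E i s \<bullet> v = 0) \<longleftrightarrow> (\<forall>i\<in>{1..j}. Z i s \<bullet> v = 0)"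
    if s: "s \<in> I" and j_le: "j \<le> ?n" for s j v
  proof (rule orthogonal_flag_of_proportional_wedges[OF _ _ j_le])
    show "E i s \<bullet> E k s = (if i = k then 1 else 0)" if "i \<in> {1..?n}" "k \<in> {1..?n}" for i k
      using inner[OF s, of i k] that by auto
    fix j assume j: "j \<in> {1..?n}"
    obtain \<epsilon> where \<epsilon>: "\<And>w. wedge (levi (\<gamma> s)) j (\<lambda>i. e i s) w
        = \<epsilon> * (wedge (levi (\<gamma> s)) j (?h s) w / wedge_norm (levi (\<gamma> s)) j (?h s))"
      using e_wedge[OF s j] by blast
    have "wedge (\<bullet>) j (\<lambda>i. E i s) w
        = (\<epsilon> / wedge_norm (levi (\<gamma> s)) j (?h s)) * wedge (\<bullet>) j (\<lambda>i. Z i s) w" for w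
    proof -
      have "wedge (levi (\<gamma> s)) j (\<lambda>i. e i s) (\<lambda>i. lift_at (\<gamma> s) (w i)) = wedge (\<bullet>) j (\<lambda>i. E i s) w"
        using wedge_levi_lift_at[of j "\<lambda>i. e i s" "\<gamma> s" "\<lambda>i. E i s" "\<lambda>i. lift_at (\<gamma> s) (w i)"]
          e_lift[OF _ s] j by simp
      moreover have "wedge (levi (\<gamma> s)) j (?h s) (\<lambda>i. lift_at (\<gamma> s) (w i)) = wedge (\<bullet>) j (\<lambda>i. Z i s) w"
        using wedge_levi_lift_at[of j "?h s" "\<gamma> s" "\<lambda>i. Z i s" "\<lambda>i. lift_at (\<gamma> s) (w i)"] h by simp
      ultimately show ?thesis using \<epsilon>[of "\<lambda>i. lift_at (\<gamma> s) (w i)"] by simp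
    qed
    then show "\<exists>c. \<forall>w. wedge (\<bullet>) j (\<lambda>i. E i s) w = c * wedge (\<bullet>) j (\<lambda>i. Z i s) w" by blast
  qed
  have Z_perp: "Z i s \<bullet> E k s = 0" if "s \<in> I" "i \<in> {1..?n}" "k \<in> {i<..2 * ?n}" for i k s
  proof -
    have "\<forall>m\<in>{1..i}. E m s \<bullet> E k s = 0" using inner[OF that(1)] that(2,3) by auto
    moreover have "i \<le> ?n" "i \<in> {1..i}" using that by auto
    ultimately show ?thesis using flag[OF that(1)] by blast
  qed
  have skew: "D i s \<bullet> E k s = - (E i s \<bullet> D k s)" if "i \<in> ?S" "k \<in> ?S" "s \<in> I" for i k s
    by (rule inner_constant_derivative[OF I(1) that(3) _ D[OF that(1,3)] D[OF that(2,3)]])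
       (rule inner[OF _ that(1,2)])
  have perp_D: "E j s \<bullet> D k s = 0" if "j \<in> {1..<?n}" "k \<in> {Suc j<..2 * ?n}" "s \<in> I" for j k s
  proof -
    have k: "k \<in> ?S" using that by auto
    have "\<forall>i\<in>{1..j}. Z i s \<bullet> D k s = 0"
    proof
      fix i assume i: "i \<in> {1..j}"
      then have i1: "i \<in> {1..?n}" "Suc i \<in> {1..?n}" "k \<in> {i<..2 * ?n}" "k \<in> {Suc i<..2 * ?n}"
        using that(1,2) by auto
      have "Z (Suc i) s \<bullet> E k s = - (Z i s \<bullet> D k s)"
        by (rule inner_constant_derivative[OF I(1) that(3) _ Z[OF that(3)] D[OF k that(3)]])
           (rule Z_perp[OF _ i1(1,3)])
      then show "Z i s \<bullet> D k s = 0" using Z_perp[OF that(3) i1(2,4)] by simp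
    qed
    moreover have "j \<le> ?n" "j \<in> {1..j}" using that by auto
    ultimately show ?thesis using flag[OF that(3), of j "D k s"] by blast
  qed
  have E_rot: "E (?n + m) s = rot (E m s)" if "m \<in> {1..?n}" "s \<in> I" for m s
    using frame[OF that(2)] that(1) unfolding unitary_frame_def by blast
  have D_rot: "D (?n + m) s = rot (D m s)" if m: "m \<in> {1..?n}" and s: "s \<in> I" for m s
  proof -
    have mS: "m \<in> ?S" "?n + m \<in> ?S" using m by auto
    have "((\<lambda>s. rot (E m s)) has_vector_derivative rot (D m s)) (at s)"
      by (rule bounded_linear.has_vector_derivative[OF bounded_linear_rot D[OF mS(1) s]])
    then have "(E (?n + m) has_vector_derivative rot (D m s)) (at s)"
      by (rule has_vector_derivative_transform_within_open[OF _ I(1) s]) (simp add: E_rot[OF m])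
    with D[OF mS(2) s] show ?thesis using vector_derivative_unique_at by blast
  qed
  have curv: "D j s \<bullet> E (if j < ?n then j + 1 else 2 * ?n) s = \<kappa> j s" if "j \<in> {1..?n}" "s \<in> I" for j s
  proof -
    have "(if j < ?n then j + 1 else 2 * ?n) \<in> ?S" using that by auto
    from e_lift[OF this that(2)] show ?thesis
      using curvature[OF that] by (simp add: p_curvature_def levi_eq D_def split: if_splits)
  qed
  have upper: "D i s \<bullet> E j s = chain \<kappa> i j s" if "i < j" "i \<in> {1..?n}" "j \<in> {1..?n}" "s \<in> I" for i j s
  proof (cases "j = Suc i")
    case True
    then show ?thesis using curv[OF that(2,4)] that by (simp add: chain_def)
  next
    case False
    have "E i s \<bullet> D j s = 0" by (rule perp_D) (use that False in auto)
    moreover have "chain \<kappa> i j s = 0" using False that(1) by (simp add: chain_def)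
    ultimately show ?thesis using skew[of i j s] that by simp
  qed
  have block: "D i s \<bullet> E j s = chain \<kappa> i j s" if ij: "i \<in> {1..?n}" "j \<in> {1..?n}" and s: "s \<in> I" for i j s
  proof -
    have ijS: "i \<in> ?S" "j \<in> ?S" using ij by auto
    consider "i < j" | "i = j" | "j < i" by linarith
    then show ?thesis
    proof cases
      case 1
      then show ?thesis using upper[OF _ ij s] by simp
    next
      case 2
      then show ?thesis using skew[OF ijS s] by (simp add: inner_commute chain_def)
    next
      case 3
      have "D i s \<bullet> E j s = - (D j s \<bullet> E i s)"
        using skew[OF ijS s] by (simp add: inner_commute)
      also have "\<dots> = - chain \<kappa> j i s" using upper[OF 3 ij(2,1) s] by simp
      also have "\<dots> = chain \<kappa> i j s" using chain_skew[of \<kappa> i j s] by simp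
      finally show ?thesis .
    qed
  qed
  have off_block: "D i s \<bullet> E (?n + m) s = (if i = ?n \<and> m = ?n then \<kappa> ?n s else 0)"
    if i: "i \<in> {1..?n}" and m: "m \<in> {1..?n}" and s: "s \<in> I" for i m s
  proof -
    have S: "i \<in> ?S" "m \<in> ?S" "?n + m \<in> ?S" "?n + i \<in> ?S" "?n \<in> {1..?n}" using i m by auto
    consider "i < ?n" | "i = ?n" "m = ?n" | "i = ?n" "m < ?n" using i m by fastforce
    then show ?thesis
    proof cases
      case 1
      have "E i s \<bullet> D (?n + m) s = 0" by (rule perp_D) (use 1 i m s in auto)
      then show ?thesis using skew[OF S(1,3) s] 1 by simp
    next
      case 2
      then show ?thesis using curv[OF i s] by (simp add: mult_2)
    next
      case 3
      \<comment> \<open>Moving the derivative and \<open>rot\<close> across the inner products turns this entry into one that is known to vanish.\<close>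
      have "D i s \<bullet> E (?n + m) s = - (E i s \<bullet> rot (D m s))"
        using skew[OF S(1,3) s] D_rot[OF m s] by simp
      also have "\<dots> = E (?n + i) s \<bullet> D m s"
        unfolding E_rot[OF i s] inner_rot_left by simp
      also have "\<dots> = - (E m s \<bullet> D (?n + i) s)"
        using skew[OF S(2,4) s] by (simp add: inner_commute)
      also have "E m s \<bullet> D (?n + i) s = 0" by (rule perp_D) (use 3 i m s in auto)
      finally show ?thesis using 3 by simp
    qed
  qed
  have coefficients: "D i s \<bullet> E j s = frenet ?n \<kappa> i j s" if ij: "i \<in> ?S" "j \<in> ?S" and s: "s \<in> I" for i j s
  proof -
    have shift: "k - ?n \<in> {1..?n}" "?n + (k - ?n) = k" if "k \<in> ?S" "\<not> k \<le> ?n" for k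
      using that by auto
    show ?thesis
    proof (cases "i \<le> ?n")
      case i: True
      then have i': "i \<in> {1..?n}" using ij by auto
      show ?thesis
      proof (cases "j \<le> ?n")
        case True
        then have "j \<in> {1..?n}" using ij by auto
        from block[OF i' this s] show ?thesis using i True by (simp add: frenet_def)
      next
        case False
        note sh = shift[OF ij(2) False]
        have "j - ?n = ?n \<longleftrightarrow> j = 2 * ?n" using False by auto
        then show ?thesis using off_block[OF i' sh(1) s] i False unfolding sh(2) by (simp add: frenet_def)
      qed
    next
      case i: False
      note shi = shift[OF ij(1) i]
      show ?thesis
      proof (cases "j \<le> ?n")
        case True
        then have j': "j \<in> {1..?n}" using ij by auto
        have "i - ?n = ?n \<longleftrightarrow> i = 2 * ?n" using i by auto
        then have "D j s \<bullet> E i s = - frenet ?n \<kappa> i j s"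
          using off_block[OF j' shi(1) s] i True unfolding shi(2) by (simp add: frenet_def)
        then show ?thesis using skew[OF ij s] by (simp add: inner_commute)
      next
        case False
        note shj = shift[OF ij(2) False]
        have "D (?n + (i - ?n)) s \<bullet> E (?n + (j - ?n)) s = chain \<kappa> (i - ?n) (j - ?n) s"
          unfolding D_rot[OF shi(1) s] E_rot[OF shj(1) s] inner_rot_rot by (rule block[OF shi(1) shj(1) s])
        then show ?thesis unfolding shi(2) shj(2) using i False by (simp add: frenet_def)
      qed
    qed
  qed
  have system: "(E i has_vector_derivative (\<Sum>j\<in>?S. frenet ?n \<kappa> i j s *\<^sub>R E j s)) (at s)"
    if "i \<in> ?S" "s \<in> I" for i s
  proof -
    have "(\<Sum>j\<in>?S. frenet ?n \<kappa> i j s *\<^sub>R E j s) = (\<Sum>j\<in>?S. (D i s \<bullet> E j s) *\<^sub>R E j s)"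
      using that coefficients by (intro sum.cong refl) simp
    also have "\<dots> = D i s" by (rule unitary_frame_expansion[OF frame[OF that(2)]])
    finally show ?thesis using D[OF that] by simp
  qed
  define \<epsilon> where "\<epsilon> s = Z 1 s \<bullet> E 1 s" for s
  have Z1: "Z 1 s = \<epsilon> s *\<^sub>R E 1 s \<and> \<epsilon> s * \<epsilon> s = 1" if s: "s \<in> I" for s
  proof -
    have unit: "Z 1 s \<bullet> Z 1 s = 1"
      using arclength s unfolding horizontal_arclength_def h levi_eq proj_lift_at contact_form_lift_at
      by fastforce
    \<comment> \<open>\<open>v\<close> is orthogonal to \<open>E\<^sub>1\<close>, hence to \<open>Z\<^sub>1\<close>, hence to itself.\<close>
    define v where "v = Z 1 s - \<epsilon> s *\<^sub>R E 1 s"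
    have "E 1 s \<bullet> v = 0"
      using inner[OF s one(2,2)] unfolding v_def \<epsilon>_def by (simp add: inner_diff_right inner_commute)
    then have "\<forall>i\<in>{1..1}. E i s \<bullet> v = 0" by simp
    moreover have "1 \<le> ?n" using one by simp
    ultimately have "Z 1 s \<bullet> v = 0" using flag[OF s, of 1 v] by simp
    then have sq: "\<epsilon> s * \<epsilon> s = 1"
      using unit unfolding v_def by (simp add: inner_diff_right \<epsilon>_def)
    have "v \<bullet> v = Z 1 s \<bullet> v - \<epsilon> s * (E 1 s \<bullet> v)" by (simp add: v_def inner_diff_left)
    also have "\<dots> = 0" using \<open>Z 1 s \<bullet> v = 0\<close> \<open>E 1 s \<bullet> v = 0\<close> by simp
    finally show ?thesis using sq by (simp add: v_def)
  qed
  have "\<epsilon> constant_on I"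
  proof (rule continuous_finite_range_constant)
    show "connected I" using I(2) by (simp add: is_interval_connected)
    show "continuous_on I \<epsilon>"
      unfolding \<epsilon>_def[abs_def]
      by (intro continuous_on_inner continuous_at_imp_continuous_on ballI
           has_vector_derivative_continuous[OF Z] has_vector_derivative_continuous[OF D[OF one(2)]])
    have "\<epsilon> ` I \<subseteq> {1, -1}" using Z1 square_eq_1_iff by auto
    then show "finite (\<epsilon> ` I)" by (rule finite_subset) simp
  qed
  then obtain c where c: "\<And>s. s \<in> I \<Longrightarrow> \<epsilon> s = c" unfolding constant_on_def by blast
  have "c * c = 1" using I(3) Z1 c by fastforce
  moreover have "proj (vector_derivative \<gamma> (at s)) = c *\<^sub>R E 1 s" if "s \<in> I" for s
    using Z1[OF that] c[OF that] by (simp add: Z_def nth_vector_derivative_Suc)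
  ultimately show ?thesis using that[OF frame system] by blast
qed

text \<open>
  A constant unitary map \<open>U\<close> matches the two frames at one time and hence at all times.  The velocities are
  \<open>\<epsilon>\<^sub>1 E\<^sub>1\<close> and \<open>\<epsilon>\<^sub>2 F\<^sub>1\<close>, so \<open>U\<close> has to be corrected by the sign \<open>\<epsilon>\<^sub>1 \<epsilon>\<^sub>2\<close>, which does not affect
  unitarity.
\<close>

theorem curve_with_invariants_unique:
  fixes \<gamma>\<^sub>1 \<gamma>\<^sub>2 :: "real \<Rightarrow> 'n::finite heis"
  assumes I: "open I" "is_interval I" "I \<noteq> {}"
    and inv1: "curve_with_invariants I \<kappa> \<tau> \<gamma>\<^sub>1" and inv2: "curve_with_invariants I \<kappa> \<tau> \<gamma>\<^sub>2"
  shows "\<exists>\<Phi>\<in>PSH. \<forall>s\<in>I. \<gamma>\<^sub>2 s = \<Phi> (\<gamma>\<^sub>1 s)"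
proof -
  let ?n = "CARD('n)" and ?S = "{1..2 * CARD('n)}"
  have one: "1 \<in> ?S" by (auto simp: Suc_le_eq)
  obtain t0 where t0: "t0 \<in> I" using I(3) by blast
  have contact: "contact_form (\<gamma> s) (vector_derivative \<gamma> (at s)) = \<tau> s"
    and \<gamma>': "(\<gamma> has_vector_derivative vector_derivative \<gamma> (at s)) (at s)"
    if "curve_with_invariants I \<kappa> \<tau> \<gamma>" "s \<in> I" for \<gamma> :: "real \<Rightarrow> 'n heis" and s
  proof -
    show "contact_form (\<gamma> s) (vector_derivative \<gamma> (at s)) = \<tau> s"
      using that unfolding curve_with_invariants_def has_contact_normality_iff by blast
    have "smooth_on I \<gamma>"
      using that unfolding curve_with_invariants_def nondegenerate_def horizontally_regular_def by blast
    then show "(\<gamma> has_vector_derivative vector_derivative \<gamma> (at s)) (at s)"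
      using smooth_on_curve_derivative(1)[OF I(1)] that(2) by blast
  qed
  obtain E and \<epsilon>\<^sub>1 :: real where E: "\<And>s. s \<in> I \<Longrightarrow> unitary_frame (\<lambda>i. E i s)"
    and E': "\<And>i s. i \<in> ?S \<Longrightarrow> s \<in> I \<Longrightarrow> (E i has_vector_derivative (\<Sum>j\<in>?S. frenet ?n \<kappa> i j s *\<^sub>R E j s)) (at s)"
    and \<epsilon>\<^sub>1: "\<epsilon>\<^sub>1 * \<epsilon>\<^sub>1 = 1" and velocity1: "\<And>s. s \<in> I \<Longrightarrow> proj (vector_derivative \<gamma>\<^sub>1 (at s)) = \<epsilon>\<^sub>1 *\<^sub>R E 1 s"
    by (rule curve_with_invariants_frenet_frame[OF I inv1]) blast
  obtain F and \<epsilon>\<^sub>2 :: real where F: "\<And>s. s \<in> I \<Longrightarrow> unitary_frame (\<lambda>i. F i s)"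
    and F': "\<And>i s. i \<in> ?S \<Longrightarrow> s \<in> I \<Longrightarrow> (F i has_vector_derivative (\<Sum>j\<in>?S. frenet ?n \<kappa> i j s *\<^sub>R F j s)) (at s)"
    and \<epsilon>\<^sub>2: "\<epsilon>\<^sub>2 * \<epsilon>\<^sub>2 = 1" and velocity2: "\<And>s. s \<in> I \<Longrightarrow> proj (vector_derivative \<gamma>\<^sub>2 (at s)) = \<epsilon>\<^sub>2 *\<^sub>R F 1 s"
    by (rule curve_with_invariants_frenet_frame[OF I inv2]) blast
  define U where "U u = (\<Sum>i\<in>?S. (u \<bullet> E i t0) *\<^sub>R F i t0)" for u
  note change = unitary_frame_change[OF E[OF t0] F[OF t0], folded U_def]
  have U: "bounded_linear U" using change(1) by (simp add: linear_conv_bounded_linear)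
  have UE': "((\<lambda>s. U (E i s)) has_vector_derivative (\<Sum>j\<in>?S. frenet ?n \<kappa> i j s *\<^sub>R U (E j s))) (at s)"
    if "i \<in> ?S" "s \<in> I" for i s
    using bounded_linear.has_vector_derivative[OF U E'[OF that]]
    by (simp add: linear_sum[OF change(1)] linear_scale[OF change(1)])
  have UE: "U (E i s) = F i s" if "i \<in> ?S" "s \<in> I" for i s
    by (rule skew_system_unique[where y = "\<lambda>i s. U (E i s)" and z = F and a = "frenet ?n \<kappa>" and S = ?S,
          OF I(2) t0 finite_atLeastAtMost frenet_skew UE' F' change(4) that])
  define \<sigma> where "\<sigma> = \<epsilon>\<^sub>1 * \<epsilon>\<^sub>2"
  define V where "V u = \<sigma> *\<^sub>R U u" for u
  have \<sigma>: "\<sigma> * \<sigma> = 1"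
  proof -
    have "\<sigma> * \<sigma> = (\<epsilon>\<^sub>1 * \<epsilon>\<^sub>1) * (\<epsilon>\<^sub>2 * \<epsilon>\<^sub>2)" by (simp add: \<sigma>_def mult_ac)
    then show ?thesis using \<epsilon>\<^sub>1 \<epsilon>\<^sub>2 by simp
  qed
  have V: "linear V"
    unfolding V_def[abs_def] by (intro linear_compose_scale_right change(1))
  have V_iso: "V u \<bullet> V v = u \<bullet> v" for u v
  proof -
    have "V u \<bullet> V v = (\<sigma> * \<sigma>) * (U u \<bullet> U v)" by (simp add: V_def mult_ac)
    then show ?thesis using \<sigma> change(2) by simp
  qed
  have V_rot: "V (rot u) = rot (V u)" for u
    unfolding V_def change(3) by (simp add: linear_scale[OF bounded_linear.linear[OF bounded_linear_rot]])
  have V_bounded: "bounded_linear V" using V by (simp add: linear_conv_bounded_linear)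
  have V_velocity: "V (proj (vector_derivative \<gamma>\<^sub>1 (at s))) = proj (vector_derivative \<gamma>\<^sub>2 (at s))" if "s \<in> I" for s
  proof -
    have "V (proj (vector_derivative \<gamma>\<^sub>1 (at s))) = (\<sigma> * \<epsilon>\<^sub>1) *\<^sub>R F 1 s"
      unfolding velocity1[OF that] V_def linear_scale[OF change(1)] UE[OF one that] by simp
    also have "\<sigma> * \<epsilon>\<^sub>1 = (\<epsilon>\<^sub>1 * \<epsilon>\<^sub>1) * \<epsilon>\<^sub>2" by (simp add: \<sigma>_def mult_ac)
    finally show ?thesis using \<epsilon>\<^sub>1 velocity2[OF that] by simp
  qed
  have "((\<lambda>s. proj (\<gamma>\<^sub>2 s) - V (proj (\<gamma>\<^sub>1 s))) has_vector_derivative 0) (at s)" if "s \<in> I" for s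
    using has_vector_derivative_diff[OF proj_has_vector_derivative[OF \<gamma>'[OF inv2 that]]
        bounded_linear.has_vector_derivative[OF V_bounded proj_has_vector_derivative[OF \<gamma>'[OF inv1 that]]]]
    by (simp add: V_velocity[OF that])
  then obtain c where "\<forall>s\<in>I. proj (\<gamma>\<^sub>2 s) - V (proj (\<gamma>\<^sub>1 s)) = c" using zero_derivative_imp_constant[OF I(2)] by blast
  then have c: "proj (\<gamma>\<^sub>2 s) = V (proj (\<gamma>\<^sub>1 s)) + c" if "s \<in> I" for s
    using that by (auto simp: algebra_simps)
  \<comment> \<open>The difference of the last coordinates of \<open>\<gamma>\<^sub>2\<close> and of \<open>rigid_motion V c 0 \<circ> \<gamma>\<^sub>1\<close>.\<close>
  define height where "height s = snd (snd (\<gamma>\<^sub>2 s)) - snd (snd (\<gamma>\<^sub>1 s)) + rot c \<bullet> V (proj (\<gamma>\<^sub>1 s))" for s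
  have "(height has_vector_derivative 0) (at s)" if s: "s \<in> I" for s
  proof -
    let ?v1 = "vector_derivative \<gamma>\<^sub>1 (at s)" and ?v2 = "vector_derivative \<gamma>\<^sub>2 (at s)"
    have snd2: "bounded_linear (\<lambda>v :: 'n heis. snd (snd v))"
      by (intro bounded_linear_snd_comp bounded_linear_snd)
    note snd' = bounded_linear.has_vector_derivative[OF snd2]
    have "(height has_vector_derivative snd (snd ?v2) - snd (snd ?v1) + rot c \<bullet> V (proj ?v1)) (at s)"
      unfolding height_def[abs_def]
      by (intro has_vector_derivative_add has_vector_derivative_diff snd'[OF \<gamma>'[OF inv2 s]] snd'[OF \<gamma>'[OF inv1 s]]
           bounded_linear.has_vector_derivative[OF bounded_linear_inner_right]
           bounded_linear.has_vector_derivative[OF V_bounded proj_has_vector_derivative[OF \<gamma>'[OF inv1 s]]])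
    moreover have "snd (snd ?v2) - snd (snd ?v1) + rot c \<bullet> V (proj ?v1) = 0"
    proof -
      have "snd (snd ?v1) + rot (proj (\<gamma>\<^sub>1 s)) \<bullet> proj ?v1 = snd (snd ?v2) + rot (proj (\<gamma>\<^sub>2 s)) \<bullet> proj ?v2"
        using contact[OF inv1 s] contact[OF inv2 s] by (simp add: contact_form_eq)
      moreover have "rot (proj (\<gamma>\<^sub>2 s)) \<bullet> proj ?v2 = rot (proj (\<gamma>\<^sub>1 s)) \<bullet> proj ?v1 + rot c \<bullet> V (proj ?v1)"
        unfolding c[OF s] V_velocity[OF s, symmetric]
          linear_add[OF bounded_linear.linear[OF bounded_linear_rot]] inner_add_left V_rot[symmetric] V_iso ..
      ultimately show ?thesis by simp
    qed
    ultimately show ?thesis by simp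
  qed
  then obtain d where d: "\<forall>s\<in>I. height s = d" using zero_derivative_imp_constant[OF I(2)] by blast
  have "\<gamma>\<^sub>2 s = rigid_motion V c d (\<gamma>\<^sub>1 s)" if "s \<in> I" for s
  proof (rule tangent_vector_eqI[of _ _ 0])
    show "proj (\<gamma>\<^sub>2 s) = proj (rigid_motion V c d (\<gamma>\<^sub>1 s))"
      unfolding proj_rigid_motion by (rule c[OF that])
    moreover have "snd (snd (\<gamma>\<^sub>2 s)) = snd (snd (rigid_motion V c d (\<gamma>\<^sub>1 s)))"
      using bspec[OF d that] by (simp add: rigid_motion_def height_def)
    ultimately show "contact_form 0 (\<gamma>\<^sub>2 s) = contact_form 0 (rigid_motion V c d (\<gamma>\<^sub>1 s))"
      by (simp add: contact_form_eq)
  qed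
  then show ?thesis using rigid_motion_in_PSH[OF V V_iso V_rot] by blast
qed

section \<open>The classification theorem\<close>

theorem theorem1p2:
  fixes I :: "real set" and \<kappa> :: "nat \<Rightarrow> real \<Rightarrow> real" and \<tau> :: "real \<Rightarrow> real"
  assumes "open I" and "is_interval I" and "I \<noteq> {}"
    and "\<And>j. j \<in> {1..CARD('n::finite)} \<Longrightarrow> smooth_on I (\<kappa> j)"
    and "smooth_on I \<tau>"
  shows "((\<forall>j\<in>{1..<CARD('n)}. \<forall>s\<in>I. \<kappa> j s \<noteq> 0) \<longrightarrow>
            (\<exists>\<gamma> :: real \<Rightarrow> 'n heis. curve_with_invariants I \<kappa> \<tau> \<gamma>))
       \<and> (\<forall>\<gamma>\<^sub>1 \<gamma>\<^sub>2 :: real \<Rightarrow> 'n heis.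
            curve_with_invariants I \<kappa> \<tau> \<gamma>\<^sub>1 \<and> curve_with_invariants I \<kappa> \<tau> \<gamma>\<^sub>2 \<longrightarrow>
            (\<exists>\<Phi>\<in>PSH. \<forall>s\<in>I. \<gamma>\<^sub>2 s = \<Phi> (\<gamma>\<^sub>1 s)))"
proof (intro conjI impI allI)
  assume "\<forall>j\<in>{1..<CARD('n)}. \<forall>s\<in>I. \<kappa> j s \<noteq> 0"
  then show "\<exists>\<gamma> :: real \<Rightarrow> 'n heis. curve_with_invariants I \<kappa> \<tau> \<gamma>"
    by (intro curve_with_invariants_exists[OF assms]) blast+
next
  fix \<gamma>\<^sub>1 \<gamma>\<^sub>2 :: "real \<Rightarrow> 'n heis"
  assume "curve_with_invariants I \<kappa> \<tau> \<gamma>\<^sub>1 \<and> curve_with_invariants I \<kappa> \<tau> \<gamma>\<^sub>2"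
  then show "\<exists>\<Phi>\<in>PSH. \<forall>s\<in>I. \<gamma>\<^sub>2 s = \<Phi> (\<gamma>\<^sub>1 s)"
    using curve_with_invariants_unique[OF assms(1-3)] by blast
qed

end
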